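(* For each path-connected space $X$ there is a universal Peano covering map $p\colon Y\to X$ with $Y$ non-empty. That is, $p$ is a Peano covering map such that for each Peano covering map $q\colon Z\to X$ and any points $z_0\in Z$ and $y_0\in Y$ satisfying $q(z_0)=p(y_0)$, there is a Peano covering map $r\colon Y\to Z$ with $q\circ r=p$ and $r(y_0)=z_0$. Moreover, the image of $\pi_1(Y)$ in $\pi_1(X)$ is normal, i.e. for $y_0\in Y$ the image of $\pi_1(p)\colon\pi_1(Y,y_0)\to\pi_1(X,p(y_0))$ is a normal subgroup of $\pi_1(X,p(y_0))$.
   Context: Maps are continuous; path-connected spaces are non-empty. A map $f\colon A\to B$ is a Peano map if the family of path components of $f^{-1}(U)$, $U$ open in $B$, forms a basis of (open) neighborhoods of $A$. A map is a Serre fibration if it has the homotopy lifting property with respect to all cubes $I^n$, $n\ge 0$. A map $f\colon A\to B$ is a Peano covering map if it is a Peano map, it is a Serre fibration, and the fibers of $f$ have trivial (one-point) path components. *)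

theory Defs
  imports "HOL-Analysis.Analysis" "HOL-Algebra.Coset"
begin

section \<open>Peano covering maps\<close>

text \<open>
  Spaces are abstract topologies. A map between spaces is a total function of which only the
  values on the \<^term>\<open>topspace\<close> of the domain matter.
\<close>

definition Peano_map :: "'a topology \<Rightarrow> 'b topology \<Rightarrow> ('a \<Rightarrow> 'b) \<Rightarrow> bool" where
  "Peano_map A B f \<longleftrightarrow>
     continuous_map A B f \<and>
     openin A = arbitrary union_of
       (\<lambda>C. \<exists>U. openin B U \<and>
             C \<in> path_components_of (subtopology A {a \<in> topspace A. f a \<in> U}))"

text \<open>For \<open>n = 0\<close> the cube is the one-point space.\<close>

definition cube :: "nat \<Rightarrow> (nat \<Rightarrow> real) topology" where
  "cube n = product_topology (\<lambda>_. top_of_set {0..1}) {..<n}"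

definition Serre_fibration :: "'a topology \<Rightarrow> 'b topology \<Rightarrow> ('a \<Rightarrow> 'b) \<Rightarrow> bool" where
  "Serre_fibration A B f \<longleftrightarrow>
     continuous_map A B f \<and>
     (\<forall>n H g.
        continuous_map (prod_topology (cube n) (top_of_set {0..1::real})) B H \<and>
        continuous_map (cube n) A g \<and>
        (\<forall>s \<in> topspace (cube n). f (g s) = H (s, 0)) \<longrightarrow>
        (\<exists>K. continuous_map (prod_topology (cube n) (top_of_set {0..1::real})) A K \<and>
             (\<forall>s \<in> topspace (cube n). K (s, 0) = g s) \<and>
             (\<forall>s \<in> topspace (cube n). \<forall>t \<in> {0..1}. f (K (s, t)) = H (s, t))))"

definition Peano_covering_map :: "'a topology \<Rightarrow> 'b topology \<Rightarrow> ('a \<Rightarrow> 'b) \<Rightarrow> bool" where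
  "Peano_covering_map A B f \<longleftrightarrow>
     Peano_map A B f \<and>
     Serre_fibration A B f \<and>
     (\<forall>b \<in> topspace B.
        \<forall>C \<in> path_components_of (subtopology A {a \<in> topspace A. f a = b}). \<exists>a. C = {a})"

text \<open>
  HOL cannot quantify over types inside a formula, so the type \<open>'z\<close> carrying the total
  spaces \<open>Z\<close> against which \<open>p\<close> is tested is a parameter. No restriction is placed on \<open>Z\<close>
  beyond that.
\<close>

definition universal_Peano_covering_map ::
    "'z itself \<Rightarrow> 'y topology \<Rightarrow> 'x topology \<Rightarrow> ('y \<Rightarrow> 'x) \<Rightarrow> bool" where
  "universal_Peano_covering_map (_ :: 'z itself) Y X p \<longleftrightarrow>
     Peano_covering_map Y X p \<and>
     (\<forall>(Z :: 'z topology) q. Peano_covering_map Z X q \<longrightarrow>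
        (\<forall>z0 \<in> topspace Z. \<forall>y0 \<in> topspace Y. q z0 = p y0 \<longrightarrow>
           (\<exists>r. Peano_covering_map Y Z r \<and>
                (\<forall>y \<in> topspace Y. q (r y) = p y) \<and>
                r y0 = z0)))"

section \<open>The fundamental group of an abstract topology\<close>

text \<open>
  Loops are functions on all of \<open>real\<close> of which only the values on \<open>[0,1]\<close> matter: two
  functions that agree there are in the same class. The homotopy below is relative to endpoints;
  related functions are automatically continuous on \<open>[0,1]\<close> and start and end at \<open>x\<close>.
\<close>

definition loop_class :: "'a topology \<Rightarrow> 'a \<Rightarrow> (real \<Rightarrow> 'a) \<Rightarrow> (real \<Rightarrow> 'a) set" where
  "loop_class X x g =
     {h. homotopic_with (\<lambda>k. k 0 = x \<and> k 1 = x) (top_of_set {0..1}) X g h}"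

definition loops_at :: "'a topology \<Rightarrow> 'a \<Rightarrow> (real \<Rightarrow> 'a) set" where
  "loops_at X x = {g. pathin X g \<and> g 0 = x \<and> g 1 = x}"

text \<open>The library's \<^const>\<open>joinpaths\<close> is confined to types of class
  \<^class>\<open>topological_space\<close>; this is the same formula without that restriction.\<close>

definition loop_concat :: "(real \<Rightarrow> 'a) \<Rightarrow> (real \<Rightarrow> 'a) \<Rightarrow> real \<Rightarrow> 'a" where
  "loop_concat g h = (\<lambda>t. if t \<le> 1/2 then g (2 * t) else h (2 * t - 1))"

text \<open>Operations on classes are given by unions over all representatives, which all
  contribute the same class.\<close>

definition fundamental_group :: "'a topology \<Rightarrow> 'a \<Rightarrow> (real \<Rightarrow> 'a) set monoid" where
  "fundamental_group X x =
     \<lparr> carrier = loop_class X x ` loops_at X x,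
       mult = (\<lambda>a b. \<Union>g\<in>a. \<Union>h\<in>b. loop_class X x (loop_concat g h)),
       one = loop_class X x (\<lambda>_. x) \<rparr>"

definition fundamental_group_map ::
    "'b topology \<Rightarrow> 'b \<Rightarrow> ('a \<Rightarrow> 'b) \<Rightarrow> (real \<Rightarrow> 'a) set \<Rightarrow> (real \<Rightarrow> 'b) set" where
  "fundamental_group_map B b f a = (\<Union>g\<in>a. loop_class B b (f \<circ> g))"

section \<open>A type large enough for universal Peano covering spaces\<close>

text \<open>
  A point of a path-connected Peano covering space of \<open>X\<close> is determined by the set of those
  paths in \<open>X\<close> from a base point whose lifts from a fixed point end in it. Hence sets of
  functions \<open>real \<Rightarrow> 'x\<close> suffice to carry all path-connected Peano covering spaces of \<open>X\<close>,
  up to homeomorphism. A single universal covering space that serves test spaces on every type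
  (not one that varies with the type) is expressed by asserting that a map universal for test
  spaces on \<open>'x covering_point\<close> exists, and that any such map is universal for test
  spaces on an arbitrary type \<open>'z\<close>.
\<close>

type_synonym 'x covering_point = "(real \<Rightarrow> 'x) set"

end

theory Submission
  imports Defs
begin

text \<open>
  The universal Peano covering space is a path component of one huge fibre product. Fix a base
  point \<open>x0\<close> of \<open>X\<close> and let \<open>J\<close> be the set of all triples \<open>(Z, q, z)\<close> in which \<open>q\<close> is a Peano
  covering map from \<open>Z\<close> to \<open>X\<close> and \<open>z\<close> is a point of \<open>Z\<close> over \<open>x0\<close>. The fibre product \<open>E\<close> over \<open>X\<close>
  of all these maps again has the homotopy lifting property, because homotopies can be lifted one
  coordinate at a time, and its fibres contain no non-constant paths, because their
  coordinates do not. What \<open>E\<close> may lack is local path-connectedness. This is repaired by passing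
  to the finer topology whose basis consists of the path components of the preimages of the open
  sets of \<open>X\<close>. Cubes are locally path-connected, so that maps out of them do not notice the
  change, and the result is a Peano covering map
  (\<open>Peano_covering_map_refined_fibre_product\<close>).

  Let \<open>Y\<close> be the path component of the base point. For points \<open>y0\<close> of \<open>Y\<close> and \<open>z0\<close> of \<open>Z\<close> over the
  same point of \<open>X\<close>, join the base point of \<open>Y\<close> to \<open>y0\<close> by a path, and lift the reverse of its
  image in \<open>X\<close> to \<open>Z\<close>, starting at \<open>z0\<close>; the lift ends at a point \<open>z1\<close> over \<open>x0\<close>. The coordinate
  projection of index \<open>(Z, q, z1)\<close> maps the base point to \<open>z1\<close>, hence, as lifts of paths are
  unique (\<open>unique_lift\<close>), it maps \<open>y0\<close> to \<open>z0\<close>. A continuous map between two Peano covering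
  spaces of \<open>X\<close> over \<open>X\<close> is itself a Peano covering map
  (\<open>Peano_covering_map_cancel_left\<close>), which gives universality.

  The set \<open>J\<close> only makes sense for spaces \<open>Z\<close> carried by one type. The type of sets of paths in
  \<open>X\<close> is large enough: by unique lifting, a point \<open>z\<close> in the path component of \<open>z0\<close> is determined by
  the set of the projections to \<open>X\<close> of all paths from \<open>z0\<close> to \<open>z\<close>. This coding carries every path
  component of every Peano covering space to that type (\<open>path_component_copy\<close>). It also carries
  \<open>Y\<close> there, and it reduces universality for test spaces on any type to
  universality for this one.

  Finally, universality applied to \<open>Z = Y\<close> gives a map \<open>r\<close> of \<open>Y\<close> over \<open>X\<close> that takes \<open>y0\<close> to any
  prescribed point of its fibre. If a loop \<open>m\<close> at \<open>p y0\<close> lifts to a path \<open>c\<close> from \<open>y0\<close> to \<open>y1\<close>, and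
  \<open>r\<close> takes \<open>y0\<close> to \<open>y1\<close>, then for each loop \<open>l\<close> at \<open>y0\<close> the path that follows \<open>c\<close>, \<open>r \<circ> l\<close>, and \<open>c\<close>
  reversed is a loop that projects to the conjugate of \<open>p \<circ> l\<close> by \<open>m\<close>. So the image of the
  fundamental group is normal.
\<close>

section \<open>Peano maps and Peano covering maps\<close>

text \<open>
  That the path components of preimages are open is local path-connectedness of the domain; that
  they form a basis is the last conjunct. In this form the two parts can be checked separately.
\<close>

lemma Peano_map_iff:
  "Peano_map A B f \<longleftrightarrow> continuous_map A B f \<and> locally_path_connected_space A \<and>
    (\<forall>W a. openin A W \<and> a \<in> W \<longrightarrow> (\<exists>U. openin B U \<and> f a \<in> U \<and>
      path_component_of_set (subtopology A {a \<in> topspace A. f a \<in> U}) a \<subseteq> W))"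
  (is "_ \<longleftrightarrow> ?cont \<and> ?lpc \<and> ?basis")
proof -
  define P where "P = (\<lambda>C. \<exists>U. openin B U \<and>
      C \<in> path_components_of (subtopology A {a \<in> topspace A. f a \<in> U}))"
  have Peano: "Peano_map A B f \<longleftrightarrow> ?cont \<and> (\<forall>C. P C \<longrightarrow> openin A C) \<and>
      (\<forall>W a. openin A W \<and> a \<in> W \<longrightarrow> (\<exists>C. P C \<and> a \<in> C \<and> C \<subseteq> W))"
    unfolding Peano_map_def openin_topology_base_unique P_def by (rule refl)
  have comp: "C = path_component_of_set (subtopology A {a \<in> topspace A. f a \<in> U}) a
        \<and> f a \<in> U \<and> a \<in> topspace A"
    if "C \<in> path_components_of (subtopology A {a \<in> topspace A. f a \<in> U})" "a \<in> C" for a C U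
    using that unfolding path_components_of_def
    by (auto simp: path_component_of_equiv)
  have PI: "P (path_component_of_set (subtopology A {a \<in> topspace A. f a \<in> U}) a)"
    if "openin B U" "f a \<in> U" "a \<in> topspace A" for U a
    using that unfolding P_def path_components_of_def by auto
  show ?thesis
  proof
    assume L: "Peano_map A B f"
    then have cont: ?cont and op: "\<And>C. P C \<Longrightarrow> openin A C"
      and bas: "\<And>W a. openin A W \<Longrightarrow> a \<in> W \<Longrightarrow> \<exists>C. P C \<and> a \<in> C \<and> C \<subseteq> W"
      unfolding Peano by auto
    have ?basis
    proof (intro allI impI)
      fix W a assume "openin A W \<and> a \<in> W"
      then obtain C where "P C" and "a \<in> C" and "C \<subseteq> W"
        using bas[of W a] by auto
      moreover obtain U where "openin B U"
        and C: "C \<in> path_components_of (subtopology A {a \<in> topspace A. f a \<in> U})"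
        using \<open>P C\<close> unfolding P_def by auto
      ultimately show "\<exists>U. openin B U \<and> f a \<in> U \<and>
          path_component_of_set (subtopology A {a \<in> topspace A. f a \<in> U}) a \<subseteq> W"
        using comp[OF C \<open>a \<in> C\<close>] by auto
    qed
    moreover have ?lpc
      unfolding locally_path_connected_space
    proof (intro allI impI)
      fix V a assume "openin A V \<and> a \<in> V"
      then obtain C where C: "P C" "a \<in> C" "C \<subseteq> V"
        using bas by blast
      have "path_connectedin A C"
        using C(1) unfolding P_def
        by (metis path_connectedin_path_components_of path_connectedin_subtopology)
      then show "\<exists>U. openin A U \<and> path_connectedin A U \<and> a \<in> U \<and> U \<subseteq> V"
        using C op by blast
    qed
    ultimately show "?cont \<and> ?lpc \<and> ?basis"
      using cont by blast
  next
    assume R: "?cont \<and> ?lpc \<and> ?basis"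
    show "Peano_map A B f"
      unfolding Peano
    proof (intro conjI allI impI)
      show ?cont using R by blast
    next
      fix C assume "P C"
      then obtain U where "openin B U"
        and C: "C \<in> path_components_of (subtopology A {a \<in> topspace A. f a \<in> U})"
        unfolding P_def by auto
      then have "openin A {a \<in> topspace A. f a \<in> U}"
        using R openin_continuous_map_preimage by blast
      then show "openin A C"
        using R C locally_path_connected_space_open_path_components[of A] by simp
    next
      fix W a assume W: "openin A W \<and> a \<in> W"
      then obtain U where U: "openin B U" "f a \<in> U"
        "path_component_of_set (subtopology A {a \<in> topspace A. f a \<in> U}) a \<subseteq> W"
        using R by blast
      have a: "a \<in> topspace A"
        using W openin_subset by blast
      then have "path_component_of (subtopology A {a \<in> topspace A. f a \<in> U}) a a"
        using U by (simp add: path_component_of_refl)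
      then show "\<exists>C. P C \<and> a \<in> C \<and> C \<subseteq> W"
        using PI[OF U(1,2) a] U(3) by blast
    qed
  qed
qed

text \<open>
  Path components enter only through paths: a fibre has one-point path components exactly if every
  path in it is closed. Comparing just the end points suffices, as an initial segment of a path
  in the fibre is again one.
\<close>

lemma fibers_path_trivial_iff:
  assumes "continuous_map A B f"
  shows "(\<forall>b \<in> topspace B.
           \<forall>C \<in> path_components_of (subtopology A {a \<in> topspace A. f a = b}). \<exists>a. C = {a})
     \<longleftrightarrow> (\<forall>c b. pathin A c \<and> (\<forall>t \<in> {0..1}. f (c t) = b) \<longrightarrow> c 1 = c 0)" (is "?L \<longleftrightarrow> ?R")
proof
  assume L: ?L
  show ?R
  proof (intro allI impI)
    fix c b assume c: "pathin A c \<and> (\<forall>t \<in> {0..1}. f (c t) = b)"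
    let ?F = "subtopology A {a \<in> topspace A. f a = b}"
    have "pathin ?F c"
      using c path_image_subset_topspace[of A c] by (auto simp: pathin_subtopology)
    then have comp: "path_component_of ?F (c 0) (c 1)"
      unfolding path_component_of_def by blast
    then have mem: "c 0 \<in> topspace ?F" and refl: "path_component_of ?F (c 0) (c 0)"
      using path_component_in_topspace path_component_of_refl by metis+
    have "b \<in> topspace B"
      using mem assms by (auto simp: continuous_map_def)
    then obtain a where "path_component_of_set ?F (c 0) = {a}"
      using L mem unfolding path_components_of_def by blast
    then show "c 1 = c 0"
      using comp refl by (metis mem_Collect_eq singletonD)
  qed
next
  assume R: ?R
  show ?L
  proof (intro ballI)
    fix b C
    let ?F = "subtopology A {a \<in> topspace A. f a = b}"
    assume "C \<in> path_components_of ?F"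
    then obtain a where a: "a \<in> topspace ?F" and C: "C = path_component_of_set ?F a"
      unfolding path_components_of_def by blast
    have "y = a" if "path_component_of ?F a y" for y
      using that R unfolding path_component_of_def pathin_subtopology by blast
    then have "C = {a}"
      unfolding C using a by (auto simp: path_component_of_refl)
    then show "\<exists>a. C = {a}" ..
  qed
qed

lemma Peano_covering_map_iff:
  "Peano_covering_map A B f \<longleftrightarrow> Peano_map A B f \<and> Serre_fibration A B f \<and>
     (\<forall>c b. pathin A c \<and> (\<forall>t \<in> {0..1}. f (c t) = b) \<longrightarrow> c 1 = c 0)"
  unfolding Peano_covering_map_def
  using fibers_path_trivial_iff[of A B f] by (auto simp: Peano_map_def)

lemma Peano_covering_map_continuous:
  "Peano_covering_map A B f \<Longrightarrow> continuous_map A B f"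
  by (simp add: Peano_covering_map_def Peano_map_def)

lemma Peano_covering_map_locally_path_connected:
  "Peano_covering_map A B f \<Longrightarrow> locally_path_connected_space A"
  by (simp add: Peano_covering_map_def Peano_map_iff)

lemma Peano_covering_map_basis:
  assumes "Peano_covering_map A B f" "openin A W" "a \<in> W"
  obtains U where "openin B U" "f a \<in> U"
    "path_component_of_set (subtopology A {a \<in> topspace A. f a \<in> U}) a \<subseteq> W"
proof -
  have "\<forall>W a. openin A W \<and> a \<in> W \<longrightarrow> (\<exists>U. openin B U \<and> f a \<in> U \<and>
      path_component_of_set (subtopology A {a \<in> topspace A. f a \<in> U}) a \<subseteq> W)"
    using assms(1) by (simp add: Peano_covering_map_def Peano_map_iff)
  then show thesis
    using assms(2,3) that by auto
qed

lemma Peano_covering_map_fiber_path: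
  assumes "Peano_covering_map A B f" "pathin A c" "\<And>t. t \<in> {0..1} \<Longrightarrow> f (c t) = b"
  shows "c 1 = c 0"
  using assms unfolding Peano_covering_map_iff by blast

lemma Peano_covering_map_lift:
  assumes "Peano_covering_map A B f"
    and "continuous_map (prod_topology (cube n) (top_of_set {0..1::real})) B H"
    and "continuous_map (cube n) A g"
    and "\<And>s. s \<in> topspace (cube n) \<Longrightarrow> f (g s) = H (s, 0)"
  obtains K where "continuous_map (prod_topology (cube n) (top_of_set {0..1})) A K"
    "\<And>s. s \<in> topspace (cube n) \<Longrightarrow> K (s, 0) = g s"
    "\<And>s t. s \<in> topspace (cube n) \<Longrightarrow> t \<in> {0..1} \<Longrightarrow> f (K (s, t)) = H (s, t)"
proof -
  have "\<exists>K. continuous_map (prod_topology (cube n) (top_of_set {0..1::real})) A K \<and>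
             (\<forall>s \<in> topspace (cube n). K (s, 0) = g s) \<and>
             (\<forall>s \<in> topspace (cube n). \<forall>t \<in> {0..1}. f (K (s, t)) = H (s, t))"
    using assms unfolding Peano_covering_map_def Serre_fibration_def by blast
  then show thesis
    using that by blast
qed

lemma Serre_fibrationI:
  fixes f :: "'a \<Rightarrow> 'b"
  assumes "continuous_map A B f"
    and "\<And>n (H :: (nat \<Rightarrow> real) \<times> real \<Rightarrow> 'b) g. \<lbrakk>continuous_map (prod_topology (cube n) (top_of_set {0..1::real})) B H;
        continuous_map (cube n) A g; \<And>s. s \<in> topspace (cube n) \<Longrightarrow> f (g s) = H (s, 0)\<rbrakk>
      \<Longrightarrow> \<exists>K. continuous_map (prod_topology (cube n) (top_of_set {0..1::real})) A K \<and>
             (\<forall>s \<in> topspace (cube n). K (s, 0) = g s) \<and>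
             (\<forall>s \<in> topspace (cube n). \<forall>t \<in> {0..1}. f (K (s, t)) = H (s, t))"
  shows "Serre_fibration A B f"
  using assms unfolding Serre_fibration_def by blast

section \<open>Lifting of paths\<close>

text \<open>
  The homotopy lifting property for the unit interval, transported along the homeomorphism of
  \<open>cube 1\<close>, a space of functions on a one-element set, with the interval.
\<close>

lemma Peano_covering_map_lift_square:
  assumes f: "Peano_covering_map A B f"
    and H: "continuous_map (prod_topology (top_of_set {0..1::real}) (top_of_set {0..1::real})) B H"
    and g: "pathin A g" "\<And>s. s \<in> {0..1} \<Longrightarrow> f (g s) = H (s, 0)"
  obtains K where
    "continuous_map (prod_topology (top_of_set {0..1::real}) (top_of_set {0..1::real})) A K"
    "\<And>s. s \<in> {0..1} \<Longrightarrow> K (s, 0) = g s"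
    "\<And>s t. s \<in> {0..1} \<Longrightarrow> t \<in> {0..1} \<Longrightarrow> f (K (s, t)) = H (s, t)"
proof -
  let ?I = "top_of_set {0..1::real}"
  have ev: "continuous_map (cube 1) ?I (\<lambda>\<sigma>. \<sigma> 0)"
    unfolding cube_def by (rule continuous_map_product_projection) simp
  have H': "continuous_map (prod_topology (cube 1) ?I) B (H \<circ> (\<lambda>z. (fst z 0, snd z)))"
    by (intro continuous_map_compose[OF _ H] continuous_map_pairedI
        continuous_map_compose[OF continuous_map_fst ev, unfolded o_def] continuous_map_snd)
  have g': "continuous_map (cube 1) A (g \<circ> (\<lambda>\<sigma>. \<sigma> 0))"
    using continuous_map_compose[OF ev] g(1) unfolding pathin_def by blast
  have ev_mem: "\<sigma> 0 \<in> {0..1}" if "\<sigma> \<in> topspace (cube 1)" for \<sigma>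
    using ev that by (auto simp: continuous_map_def Pi_iff)
  have start: "f ((g \<circ> (\<lambda>\<sigma>. \<sigma> 0)) \<sigma>) = (H \<circ> (\<lambda>z. (fst z 0, snd z))) (\<sigma>, 0)"
    if "\<sigma> \<in> topspace (cube 1)" for \<sigma>
    using g(2)[OF ev_mem[OF that]] by simp
  obtain K where K: "continuous_map (prod_topology (cube 1) ?I) A K"
    "\<And>s. s \<in> topspace (cube 1) \<Longrightarrow> K (s, 0) = (g \<circ> (\<lambda>\<sigma>. \<sigma> 0)) s"
    "\<And>s t. s \<in> topspace (cube 1) \<Longrightarrow> t \<in> {0..1} \<Longrightarrow> f (K (s, t)) = (H \<circ> (\<lambda>z. (fst z 0, snd z))) (s, t)"
    by (rule Peano_covering_map_lift[OF f H' g' start]) (assumption, blast)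
  \<comment> \<open>The inverse of evaluation at 0.\<close>
  define j :: "real \<Rightarrow> nat \<Rightarrow> real" where "j = (\<lambda>s. \<lambda>i\<in>{..<1}. s)"
  have j: "continuous_map ?I (cube 1) j"
    unfolding cube_def continuous_map_componentwise j_def by auto
  then have j_mem: "j s \<in> topspace (cube 1)" if "s \<in> {0..1}" for s
    using that by (auto simp: continuous_map_def Pi_iff)
  have j0: "j s 0 = s" for s
    by (simp add: j_def)
  show thesis
  proof
    show "continuous_map (prod_topology ?I ?I) A (K \<circ> (\<lambda>z. (j (fst z), snd z)))"
      by (intro continuous_map_compose[OF _ K(1)] continuous_map_pairedI
          continuous_map_compose[OF continuous_map_fst j, unfolded o_def] continuous_map_snd)
  qed (use K(2,3) j_mem j0 in auto)
qed

text \<open>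
  A path is lifted as a homotopy of the constant map with value \<open>a\<close> that is independent of the
  homotoped variable, and then restricted to one value of that variable.
\<close>

lemma path_lifting:
  assumes f: "Peano_covering_map A B f" and w: "pathin B w" and a: "a \<in> topspace A" "f a = w 0"
  obtains c where "pathin A c" "c 0 = a" "\<And>t. t \<in> {0..1} \<Longrightarrow> f (c t) = w t"
proof -
  let ?I = "top_of_set {0..1::real}"
  have "continuous_map (prod_topology ?I ?I) B (w \<circ> snd)"
    using w unfolding pathin_def by (rule continuous_map_compose[OF continuous_map_snd])
  moreover have "pathin A (\<lambda>_. a)" "\<And>s. s \<in> {0..1::real} \<Longrightarrow> f a = (w \<circ> snd) (s, 0)"
    using a by auto
  ultimately obtain K where K: "continuous_map (prod_topology ?I ?I) A K"
    "\<And>s. s \<in> {0..1} \<Longrightarrow> K (s, 0) = a"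
    "\<And>s t. s \<in> {0..1} \<Longrightarrow> t \<in> {0..1} \<Longrightarrow> f (K (s, t)) = (w \<circ> snd) (s, t)"
    by (rule Peano_covering_map_lift_square[OF f]) (assumption, blast)
  show thesis
  proof
    show "pathin A (K \<circ> Pair 0)"
      unfolding pathin_def using continuous_map_o_Pair[OF K(1)] by simp
  qed (use K in auto)
qed

lemma pathin_reparametrize:
  fixes \<phi> :: "real \<Rightarrow> real"
  assumes "pathin X g" "continuous_on {0..1} \<phi>" "\<phi> ` {0..1} \<subseteq> {0..1}"
  shows "pathin X (\<lambda>t. g (\<phi> t))"
proof -
  have "continuous_map (top_of_set {0..1}) (top_of_set {0..1}) \<phi>"
    using assms by auto
  from continuous_map_compose[OF this] assms(1) show ?thesis
    unfolding pathin_def o_def by blast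
qed

lemma pathin_reverse: "pathin X g \<Longrightarrow> pathin X (\<lambda>t. g (1 - t))"
  by (rule pathin_reparametrize) (auto intro!: continuous_intros)

text \<open>
  Concatenation of a whole family of paths; a constant family gives concatenation of paths, and
  families that are homotopies give that concatenation respects homotopy.
\<close>

lemma continuous_map_loop_concat:
  assumes g: "continuous_map (prod_topology (top_of_set {0..1::real}) (top_of_set {0..1})) X g"
    and h: "continuous_map (prod_topology (top_of_set {0..1::real}) (top_of_set {0..1})) X h"
    and join: "\<And>s. s \<in> {0..1} \<Longrightarrow> g (s, 1) = h (s, 0)"
  shows "continuous_map (prod_topology (top_of_set {0..1}) (top_of_set {0..1})) X
    (\<lambda>z. loop_concat (\<lambda>t. g (fst z, t)) (\<lambda>t. h (fst z, t)) (snd z))"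
proof -
  let ?Q = "prod_topology (top_of_set {0..1::real}) (top_of_set {0..1::real})"
  have Q: "?Q = top_of_set ({0..1} \<times> {0..1})"
    by simp
  have "continuous_map ?Q X (\<lambda>z. if snd z \<le> 1/2 then (g \<circ> (\<lambda>z. (fst z, 2 * snd z))) z
      else (h \<circ> (\<lambda>z. (fst z, 2 * snd z - 1))) z)"
  proof (rule continuous_map_cases_le)
    show "continuous_map ?Q euclideanreal snd" "continuous_map ?Q euclideanreal (\<lambda>z. 1/2)"
      unfolding Q by (auto intro!: continuous_intros)
    show "continuous_map (subtopology ?Q {x \<in> topspace ?Q. snd x \<le> 1/2}) X
        (g \<circ> (\<lambda>z. (fst z, 2 * snd z)))"
      by (rule continuous_map_compose[OF _ g])
        (unfold Q subtopology_subtopology, auto intro!: continuous_intros)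
    show "continuous_map (subtopology ?Q {x \<in> topspace ?Q. 1/2 \<le> snd x}) X
        (h \<circ> (\<lambda>z. (fst z, 2 * snd z - 1)))"
      by (rule continuous_map_compose[OF _ h])
        (unfold Q subtopology_subtopology, auto intro!: continuous_intros)
  next
    fix x :: "real \<times> real" assume x: "x \<in> topspace ?Q" "snd x = 1/2"
    have "2 * snd x = 1" "2 * snd x - 1 = 0" "fst x \<in> {0..1}"
      using x by auto
    then show "(g \<circ> (\<lambda>z. (fst z, 2 * snd z))) x = (h \<circ> (\<lambda>z. (fst z, 2 * snd z - 1))) x"
      using join by simp
  qed
  then show ?thesis
    unfolding loop_concat_def comp_def .
qed

lemma pathin_loop_concat:
  assumes "pathin X g" "pathin X h" "g 1 = h 0"
  shows "pathin X (loop_concat g h)"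
proof -
  let ?I = "top_of_set {0..1::real}"
  have "continuous_map (prod_topology ?I ?I) X (g \<circ> snd)" "continuous_map (prod_topology ?I ?I) X (h \<circ> snd)"
    using assms(1,2) continuous_map_compose[OF continuous_map_snd] unfolding pathin_def by blast+
  from continuous_map_loop_concat[OF this]
  have "continuous_map (prod_topology ?I ?I) X (\<lambda>z. loop_concat g h (snd z))"
    using assms(3) by simp
  from continuous_map_o_Pair[OF this, of 0] show ?thesis
    by (simp add: pathin_def o_def)
qed

lemma loop_concat_ends [simp]:
  "loop_concat g h 0 = g 0" "loop_concat g h 1 = h 1"
  by (simp_all add: loop_concat_def)

text \<open>
  Run backwards along \<open>c\<close> and then forwards along \<open>d\<close>. The projection of this path to \<open>B\<close> retraces its
  own steps, so it contracts to the constant path at its end point while its end points stay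
  fixed. Lift this contraction: the other three sides of the square go to a single fibre, where
  paths cannot move, so both ends of the lifted path agree.
\<close>

lemma unique_lift_end:
  assumes f: "Peano_covering_map A B f" and c: "pathin A c" and d: "pathin A d"
    and start: "c 0 = d 0" and proj: "\<And>t. t \<in> {0..1} \<Longrightarrow> f (c t) = f (d t)"
  shows "c 1 = d 1"
proof -
  let ?I = "top_of_set {0..1::real}"
  define g where "g = loop_concat (\<lambda>t. c (1 - t)) d"
  define \<mu> where "\<mu> = (\<lambda>z :: real \<times> real. max \<bar>1 - 2 * fst z\<bar> (snd z))"
  have g: "pathin A g"
    unfolding g_def by (rule pathin_loop_concat[OF pathin_reverse[OF c] d]) (simp add: start)
  have "continuous_map (prod_topology ?I ?I) ?I \<mu>"
    unfolding \<mu>_def by (auto intro!: continuous_intros)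
  moreover have "continuous_map ?I B (f \<circ> d)"
    using pathin_compose[OF d Peano_covering_map_continuous[OF f]] by (simp add: pathin_def)
  ultimately have H: "continuous_map (prod_topology ?I ?I) B (f \<circ> d \<circ> \<mu>)"
    by (rule continuous_map_compose)
  have fg: "f (g s) = (f \<circ> d \<circ> \<mu>) (s, 0)" if "s \<in> {0..1}" for s
  proof (cases "s \<le> 1/2")
    case True
    then show ?thesis
      using that proj[of "1 - 2 * s"] by (simp add: g_def loop_concat_def \<mu>_def)
  next
    case False
    then show ?thesis
      using that by (simp add: g_def loop_concat_def \<mu>_def)
  qed
  obtain K where K: "continuous_map (prod_topology ?I ?I) A K"
    "\<And>s. s \<in> {0..1} \<Longrightarrow> K (s, 0) = g s"
    "\<And>s t. s \<in> {0..1} \<Longrightarrow> t \<in> {0..1} \<Longrightarrow> f (K (s, t)) = (f \<circ> d \<circ> \<mu>) (s, t)"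
    by (rule Peano_covering_map_lift_square[OF f H g fg]) (assumption, blast)
  \<comment> \<open>The left, right and upper sides of the square lie over the common end point.\<close>
  have fiber: "f (K (0, t)) = f (d 1)" "f (K (1, t)) = f (d 1)" "f (K (t, 1)) = f (d 1)"
    if "t \<in> {0..1}" for t
    using K(3)[of 0 t] K(3)[of 1 t] K(3)[of t 1] that
    by (auto simp: \<mu>_def max_def abs_if)
  have const: "(K \<circ> e) 1 = (K \<circ> e) 0"
    if "continuous_map ?I (prod_topology ?I ?I) e" "\<And>t. t \<in> {0..1} \<Longrightarrow> f (K (e t)) = f (d 1)" for e
  proof (rule Peano_covering_map_fiber_path[OF f])
    show "pathin A (K \<circ> e)"
      unfolding pathin_def by (rule continuous_map_compose[OF that(1) K(1)])
  qed (use that(2) in simp)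
  have "continuous_on {0..1::real} (\<lambda>t. (a :: real, t))"
    "continuous_on {0..1::real} (\<lambda>t. (t, a :: real))" for a
    by (intro continuous_intros)+
  then have "K (0, 0) = K (0, 1)" "K (0, 1) = K (1, 1)" "K (1, 1) = K (1, 0)"
    using const[of "\<lambda>t. (0, t)"] const[of "\<lambda>t. (t, 1)"] const[of "\<lambda>t. (1, t)"] fiber
    by (auto simp: o_def)
  then have "g 0 = g 1"
    using K(2)[of 0] K(2)[of 1] by simp
  then show ?thesis
    by (simp add: g_def)
qed

lemma unique_lift:
  assumes f: "Peano_covering_map A B f" and c: "pathin A c" and d: "pathin A d"
    and start: "c 0 = d 0" and proj: "\<And>t. t \<in> {0..1} \<Longrightarrow> f (c t) = f (d t)"
    and t: "t \<in> {0..1}"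
  shows "c t = d t"
proof -
  have scale: "(\<lambda>u. t * u) ` {0..1} \<subseteq> {0..1}"
    using t by (auto simp: mult_le_one)
  have "pathin A (\<lambda>u. c (t * u))" "pathin A (\<lambda>u. d (t * u))"
    by (rule pathin_reparametrize[OF c _ scale] pathin_reparametrize[OF d _ scale],
        intro continuous_intros)+
  moreover have "f (c (t * u)) = f (d (t * u))" if "u \<in> {0..1}" for u
    using proj scale that by blast
  ultimately show ?thesis
    using unique_lift_end[OF f, of "\<lambda>u. c (t * u)" "\<lambda>u. d (t * u)"] start by simp
qed

section \<open>Composites\<close>

lemma path_component_of_subtopology_image:
  assumes f: "continuous_map A B f"
    and xy: "path_component_of (subtopology A S) x y" and S: "\<And>a. a \<in> topspace A \<Longrightarrow> a \<in> S \<Longrightarrow> f a \<in> T"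
  shows "path_component_of (subtopology B T) (f x) (f y)"
proof (rule path_component_of_continuous_image[OF _ xy])
  show "continuous_map (subtopology A S) (subtopology B T) f"
    using f S by (auto simp: continuous_map_in_subtopology continuous_map_from_subtopology)
qed

text \<open>
  Bases pull back in two steps and homotopies lift in two steps. A path in a fibre of the composite
  projects to a path in a fibre of \<open>g\<close>, which is constant, so it already lies in a fibre of \<open>f\<close>.
\<close>

lemma Peano_covering_map_compose:
  assumes f: "Peano_covering_map A B f" and g: "Peano_covering_map B C g"
  shows "Peano_covering_map A C (g \<circ> f)"
  unfolding Peano_covering_map_iff Peano_map_iff
proof (intro conjI allI impI)
  note cf = Peano_covering_map_continuous[OF f] and cg = Peano_covering_map_continuous[OF g]
  show cgf: "continuous_map A C (g \<circ> f)"
    using cf cg by (rule continuous_map_compose)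
  show "locally_path_connected_space A"
    by (rule Peano_covering_map_locally_path_connected[OF f])
  show "\<exists>U. openin C U \<and> (g \<circ> f) a \<in> U \<and>
      path_component_of_set (subtopology A {a \<in> topspace A. (g \<circ> f) a \<in> U}) a \<subseteq> W"
    if W: "openin A W \<and> a \<in> W" for W a
  proof -
    obtain V where V: "openin B V" "f a \<in> V"
      "path_component_of_set (subtopology A {a \<in> topspace A. f a \<in> V}) a \<subseteq> W"
      by (rule Peano_covering_map_basis[OF f conjunct1[OF W] conjunct2[OF W]])
    obtain U where U: "openin C U" "g (f a) \<in> U"
      "path_component_of_set (subtopology B {b \<in> topspace B. g b \<in> U}) (f a) \<subseteq> V"
      by (rule Peano_covering_map_basis[OF g V(1,2)])
    let ?S = "{a \<in> topspace A. (g \<circ> f) a \<in> U}" and ?K = "path_component_of_set (subtopology A {a \<in> topspace A. (g \<circ> f) a \<in> U}) a"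
    have "?K \<subseteq> {a \<in> topspace A. f a \<in> V}"
    proof clarify
      fix y assume y: "path_component_of (subtopology A ?S) a y"
      have "path_component_of (subtopology B {b \<in> topspace B. g b \<in> U}) (f a) (f y)"
        by (rule path_component_of_subtopology_image[OF cf y])
          (use cf in \<open>auto simp: continuous_map_def Pi_iff\<close>)
      then show "y \<in> topspace A \<and> f y \<in> V"
        using U(3) path_component_in_topspace[OF y] by auto
    qed
    moreover have "path_connectedin A ?K"
      using path_connectedin_path_component_of[of "subtopology A ?S" a]
      unfolding path_connectedin_subtopology by (rule conjunct1)
    moreover have "a \<in> ?K"
      using W U(2) openin_subset[of A W] by (auto simp: path_component_of_refl)
    ultimately have "?K \<subseteq> path_component_of_set (subtopology A {a \<in> topspace A. f a \<in> V}) a"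
      by (intro path_component_of_maximal) (auto simp: path_connectedin_subtopology)
    then show ?thesis
      using U V by auto
  qed
  show "Serre_fibration A C (g \<circ> f)"
  proof (rule Serre_fibrationI[OF cgf])
    fix n H k
    assume H: "continuous_map (prod_topology (cube n) (top_of_set {0..1::real})) C H"
      and k: "continuous_map (cube n) A k" "\<And>s. s \<in> topspace (cube n) \<Longrightarrow> (g \<circ> f) (k s) = H (s, 0)"
    have "\<And>s. s \<in> topspace (cube n) \<Longrightarrow> g ((f \<circ> k) s) = H (s, 0)"
      using k(2) by simp
    then obtain L where L: "continuous_map (prod_topology (cube n) (top_of_set {0..1})) B L"
      "\<And>s. s \<in> topspace (cube n) \<Longrightarrow> L (s, 0) = (f \<circ> k) s"
      "\<And>s t. s \<in> topspace (cube n) \<Longrightarrow> t \<in> {0..1} \<Longrightarrow> g (L (s, t)) = H (s, t)"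
      by (rule Peano_covering_map_lift[OF g H continuous_map_compose[OF k(1) cf]]) (assumption, blast)
    then have "\<And>s. s \<in> topspace (cube n) \<Longrightarrow> f (k s) = L (s, 0)"
      by simp
    then obtain K where K: "continuous_map (prod_topology (cube n) (top_of_set {0..1})) A K"
      "\<And>s. s \<in> topspace (cube n) \<Longrightarrow> K (s, 0) = k s"
      "\<And>s t. s \<in> topspace (cube n) \<Longrightarrow> t \<in> {0..1} \<Longrightarrow> f (K (s, t)) = L (s, t)"
      by (rule Peano_covering_map_lift[OF f L(1) k(1)]) (assumption, blast)
    show "\<exists>K. continuous_map (prod_topology (cube n) (top_of_set {0..1})) A K \<and>
        (\<forall>s\<in>topspace (cube n). K (s, 0) = k s) \<and>
        (\<forall>s\<in>topspace (cube n). \<forall>t\<in>{0..1}. (g \<circ> f) (K (s, t)) = H (s, t))"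
      using K L(3) by (intro exI[of _ K]) auto
  qed
  show "c 1 = c 0" if c: "pathin A c \<and> (\<forall>t \<in> {0..1}. (g \<circ> f) (c t) = b)" for c b
  proof (rule unique_lift_end[OF f])
    show "pathin A c" using c by blast
    show "pathin A (\<lambda>_. c 0)" using c path_start_in_topspace by auto
    have fc: "pathin B (f \<circ> c)"
      using c pathin_compose[OF _ cf] by blast
    from fc have const: "pathin B (\<lambda>_. f (c 0))"
      using path_start_in_topspace by fastforce
    show "f (c t) = f (c 0)" if t: "t \<in> {0..1}" for t
    proof -
      have "(f \<circ> c) t = f (c 0)"
        by (rule unique_lift[OF g fc const _ _ t]) (use c in auto)
      then show ?thesis by simp
    qed
  qed simp
qed

text \<open>
  Preimages under \<open>p\<close> are also preimages under \<open>r\<close>, so the basis needed for \<open>r\<close> comes from the one for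
  \<open>p\<close>, and fibres of \<open>r\<close> lie in fibres of \<open>p\<close>. A homotopy in \<open>Z\<close> is lifted to \<open>Y\<close> by
  lifting its projection to \<open>X\<close> along \<open>p\<close>: the image of the result under \<open>r\<close> and the given
  homotopy both lift the same homotopy in \<open>X\<close>, hence agree by unique lifting of paths.
\<close>

lemma Peano_covering_map_cancel_left:
  assumes p: "Peano_covering_map Y X p" and q: "Peano_covering_map Z X q"
    and r: "continuous_map Y Z r" and qr: "\<And>y. y \<in> topspace Y \<Longrightarrow> q (r y) = p y"
  shows "Peano_covering_map Y Z r"
  unfolding Peano_covering_map_iff Peano_map_iff
proof (intro conjI allI impI)
  note cq = Peano_covering_map_continuous[OF q]
  show "continuous_map Y Z r" by (fact r)
  show "locally_path_connected_space Y"
    by (rule Peano_covering_map_locally_path_connected[OF p])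
  show "\<exists>V. openin Z V \<and> r a \<in> V \<and>
      path_component_of_set (subtopology Y {a \<in> topspace Y. r a \<in> V}) a \<subseteq> W"
    if W: "openin Y W \<and> a \<in> W" for W a
  proof -
    obtain U where U: "openin X U" "p a \<in> U"
      "path_component_of_set (subtopology Y {a \<in> topspace Y. p a \<in> U}) a \<subseteq> W"
      by (rule Peano_covering_map_basis[OF p conjunct1[OF W] conjunct2[OF W]])
    let ?V = "{z \<in> topspace Z. q z \<in> U}"
    have eq: "{a \<in> topspace Y. r a \<in> ?V} = {a \<in> topspace Y. p a \<in> U}"
      using qr r by (auto simp: continuous_map_def Pi_iff)
    moreover have "r a \<in> ?V"
      using W U(2) qr r openin_subset[of Y W] by (auto simp: continuous_map_def Pi_iff)
    moreover have "openin Z ?V"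
      using cq U(1) by (rule openin_continuous_map_preimage)
    ultimately show ?thesis
      using U(3) unfolding eq[symmetric] by (intro exI[of _ ?V] conjI)
  qed
  show "Serre_fibration Y Z r"
  proof (rule Serre_fibrationI[OF r])
    fix n H k
    let ?I = "top_of_set {0..1::real}"
    assume H: "continuous_map (prod_topology (cube n) ?I) Z H"
      and k: "continuous_map (cube n) Y k" "\<And>s. s \<in> topspace (cube n) \<Longrightarrow> r (k s) = H (s, 0)"
    have "p (k s) = (q \<circ> H) (s, 0)" if "s \<in> topspace (cube n)" for s
      using k that qr[of "k s"] by (auto simp: continuous_map_def Pi_iff)
    then obtain K where K: "continuous_map (prod_topology (cube n) ?I) Y K"
      "\<And>s. s \<in> topspace (cube n) \<Longrightarrow> K (s, 0) = k s"
      "\<And>s t. s \<in> topspace (cube n) \<Longrightarrow> t \<in> {0..1} \<Longrightarrow> p (K (s, t)) = (q \<circ> H) (s, t)"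
      by (rule Peano_covering_map_lift[OF p continuous_map_compose[OF H cq] k(1)]) (assumption, blast)
    have "r (K (s, t)) = H (s, t)" if st: "s \<in> topspace (cube n)" "t \<in> {0..1}" for s t
    proof -
      have "K (s, u) \<in> topspace Y" if "u \<in> {0..1}" for u
        using K(1) st(1) that by (auto simp: continuous_map_def Pi_iff)
      then have proj: "q ((r \<circ> (K \<circ> Pair s)) u) = q ((H \<circ> Pair s) u)" if "u \<in> {0..1}" for u
        using K(3)[OF st(1) that] qr that by simp
      have "pathin Z (r \<circ> (K \<circ> Pair s))"
        unfolding pathin_def
        by (rule continuous_map_compose[OF continuous_map_o_Pair[OF K(1) st(1)] r])
      moreover have "pathin Z (H \<circ> Pair s)"
        unfolding pathin_def by (rule continuous_map_o_Pair[OF H st(1)])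
      moreover have "(r \<circ> (K \<circ> Pair s)) 0 = (H \<circ> Pair s) 0"
        using K(2) k(2) st(1) by simp
      ultimately have "(r \<circ> (K \<circ> Pair s)) t = (H \<circ> Pair s) t"
        by (rule unique_lift[OF q _ _ _ proj st(2)])
      then show ?thesis by simp
    qed
    then show "\<exists>K. continuous_map (prod_topology (cube n) ?I) Y K \<and>
        (\<forall>s\<in>topspace (cube n). K (s, 0) = k s) \<and>
        (\<forall>s\<in>topspace (cube n). \<forall>t\<in>{0..1}. r (K (s, t)) = H (s, t))"
      using K(1,2) by blast
  qed
  show "c 1 = c 0" if c: "pathin Y c \<and> (\<forall>t \<in> {0..1}. r (c t) = b)" for c b
  proof (rule Peano_covering_map_fiber_path[OF p, of _ "q b"])
    show "p (c t) = q b" if "t \<in> {0..1}" for t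
      using c that path_image_subset_topspace[of Y c] qr[of "c t"] by (auto simp: Pi_iff)
  qed (use c in blast)
qed

section \<open>Replacing a covering space by a copy\<close>

text \<open>
  The code of a point \<open>z\<close> of the path component of \<open>z0\<close> is the set of projections to \<open>X\<close> of all paths
  from \<open>z0\<close> to \<open>z\<close>. It is injective because these sets are non-empty and a common element of two of
  them has a unique lift from \<open>z0\<close>. Its inverse \<open>i\<close> is, up to homeomorphism, the inclusion of an
  open path component, and such an inclusion is a Peano covering map of \<open>Z\<close>: a homotopy that
  starts in a path component never leaves it.
\<close>

lemma path_component_copy:
  fixes Z :: "'z topology" and X :: "'x topology"
  assumes q: "Peano_covering_map Z X q" and z0: "z0 \<in> topspace Z"
  obtains Z' :: "'x covering_point topology" and i z0'
  where "Peano_covering_map Z' Z i" "path_connected_space Z'" "z0' \<in> topspace Z'" "i z0' = z0"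
proof -
  define Z0 where "Z0 = path_component_of_set Z z0"
  define code where "code = (\<lambda>z. {q \<circ> c |c. pathin Z c \<and> c 0 = z0 \<and> c 1 = z})"
  define i where "i = inv_into Z0 code"
  define Z' where "Z' = pullback_topology (code ` Z0) i Z"
  have Z0_iff: "z \<in> Z0 \<longleftrightarrow> (\<exists>c. pathin Z c \<and> c 0 = z0 \<and> c 1 = z)" for z
    by (simp add: Z0_def path_component_of_def)
  have Z0_sub: "Z0 \<subseteq> topspace Z"
    unfolding Z0_def by (rule path_component_of_subset_topspace)
  have inj: "inj_on code Z0"
  proof (rule inj_onI)
    fix z z' assume "z \<in> Z0" "z' \<in> Z0" and eq: "code z = code z'"
    then obtain c where c: "pathin Z c" "c 0 = z0" "c 1 = z"
      unfolding Z0_iff by auto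
    then have "q \<circ> c \<in> code z'"
      using eq[symmetric] unfolding code_def by blast
    then obtain d where d: "q \<circ> c = q \<circ> d" "pathin Z d" "d 0 = z0" "d 1 = z'"
      unfolding code_def by blast
    have "c 1 = d 1"
      using unique_lift_end[OF q c(1) d(2)] c(2) d(3) fun_cong[OF d(1)] by simp
    then show "z = z'"
      using c d by simp
  qed
  have i_code: "i (code z) = z" if "z \<in> Z0" for z
    unfolding i_def using inj that by (rule inv_into_f_f)
  have top: "topspace Z' = code ` Z0"
    unfolding Z'_def topspace_pullback_topology using i_code Z0_sub by auto
  have ci: "continuous_map Z' Z i"
    unfolding Z'_def using continuous_map_pullback[OF continuous_map_id] by (simp add: o_def)
  have into_Z': "continuous_map D Z' (code \<circ> k)"
    if "continuous_map D Z k" "k ` topspace D \<subseteq> Z0" for D :: "'d topology" and k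
    unfolding Z'_def
  proof (rule continuous_map_pullback')
    show "continuous_map D Z (i \<circ> (code \<circ> k))"
      by (rule continuous_map_eq[OF that(1)]) (use that(2) i_code in auto)
    show "topspace D \<subseteq> (code \<circ> k) -` code ` Z0"
      using image_mono[OF that(2), of code]
      by (simp only: image_subset_iff_subset_vimage image_comp)
  qed
  have "homeomorphic_maps (subtopology Z Z0) Z' code i"
    unfolding homeomorphic_maps_def
  proof (intro conjI ballI)
    show "continuous_map (subtopology Z Z0) Z' code"
      using into_Z'[of "subtopology Z Z0" id] by simp
    show "continuous_map Z' (subtopology Z Z0) i"
      using ci top i_code by (auto simp: continuous_map_in_subtopology)
    show "i (code z) = z" if "z \<in> topspace (subtopology Z Z0)" for z
      using that i_code by simp
    show "code (i a) = a" if "a \<in> topspace Z'" for a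
      using that i_code unfolding top by force
  qed
  then have hom: "subtopology Z Z0 homeomorphic_space Z'"
    unfolding homeomorphic_space_def by blast
  have lpc: "locally_path_connected_space Z"
    by (rule Peano_covering_map_locally_path_connected[OF q])
  have "path_connected_space (subtopology Z Z0)"
    using path_connectedin_path_component_of[of Z z0] unfolding Z0_def path_connectedin_def by blast
  then have pc': "path_connected_space Z'"
    using homeomorphic_path_connected_space_imp hom by blast
  have "openin Z Z0"
    unfolding Z0_def by (rule openin_path_component_of_locally_path_connected_space[OF lpc])
  then have lpc': "locally_path_connected_space Z'"
    using homeomorphic_locally_path_connected_space[OF hom]
      locally_path_connected_space_open_subset[OF lpc] by blast
  have cov: "Peano_covering_map Z' Z i"
    unfolding Peano_covering_map_iff Peano_map_iff
  proof (intro conjI allI impI)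
    show "continuous_map Z' Z i" "locally_path_connected_space Z'"
      by (fact ci lpc')+
    show "\<exists>U. openin Z U \<and> i a \<in> U \<and>
        path_component_of_set (subtopology Z' {a \<in> topspace Z'. i a \<in> U}) a \<subseteq> W"
      if W: "openin Z' W \<and> a \<in> W" for W a
    proof -
      obtain U where U: "openin Z U" "W = i -` U \<inter> code ` Z0"
        using W unfolding Z'_def openin_pullback_topology by blast
      have "path_component_of_set (subtopology Z' {a \<in> topspace Z'. i a \<in> U}) a \<subseteq> W"
        using path_component_of_subset_topspace[of "subtopology Z' {a \<in> topspace Z'. i a \<in> U}" a]
          U(2) top by auto
      then show ?thesis
        using U W by blast
    qed
    show "Serre_fibration Z' Z i"
    proof (rule Serre_fibrationI[OF ci])
      fix n g and H :: "(nat \<Rightarrow> real) \<times> real \<Rightarrow> 'z"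
      assume H: "continuous_map (prod_topology (cube n) (top_of_set {0..1::real})) Z H"
        and g: "continuous_map (cube n) Z' g" "\<And>s. s \<in> topspace (cube n) \<Longrightarrow> i (g s) = H (s, 0)"
      have g_mem: "g s \<in> code ` Z0" if "s \<in> topspace (cube n)" for s
        using g(1) that top by (auto simp: continuous_map_def Pi_iff)
      have H_mem: "H (s, t) \<in> Z0" if s: "s \<in> topspace (cube n)" and t: "t \<in> {0..1}" for s t
      proof -
        have "pathin Z (H \<circ> Pair s)"
          unfolding pathin_def by (rule continuous_map_o_Pair[OF H s])
        then have "pathin Z (\<lambda>u. (H \<circ> Pair s) (t * u))"
          by (rule pathin_reparametrize) (use t in \<open>auto intro!: continuous_intros simp: mult_le_one\<close>)
        then have "path_component_of Z (H (s, 0)) (H (s, t))"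
          unfolding path_component_of_def by (intro exI[of _ "\<lambda>u. (H \<circ> Pair s) (t * u)"]) auto
        moreover have "H (s, 0) \<in> Z0"
          using g_mem[OF s] i_code g(2)[OF s] by auto
        ultimately show ?thesis
          unfolding Z0_def by (auto intro: path_component_of_trans)
      qed
      show "\<exists>K. continuous_map (prod_topology (cube n) (top_of_set {0..1})) Z' K \<and>
          (\<forall>s\<in>topspace (cube n). K (s, 0) = g s) \<and>
          (\<forall>s\<in>topspace (cube n). \<forall>t\<in>{0..1}. i (K (s, t)) = H (s, t))"
      proof (intro exI[of _ "code \<circ> H"] conjI ballI)
        show "continuous_map (prod_topology (cube n) (top_of_set {0..1})) Z' (code \<circ> H)"
          by (rule into_Z'[OF H]) (use H_mem in auto)
        show "(code \<circ> H) (s, 0) = g s" if "s \<in> topspace (cube n)" for s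
          using g(2)[OF that] g_mem[OF that] i_code by (auto simp flip: g(2))
      qed (use H_mem i_code in auto)
    qed
    show "c 1 = c 0" if c: "pathin Z' c \<and> (\<forall>t \<in> {0..1}. i (c t) = b)" for c b
    proof -
      have "c 0 \<in> code ` Z0" "c 1 \<in> code ` Z0"
        using c path_start_in_topspace[of Z' c] path_finish_in_topspace[of Z' c] top by auto
      moreover have "i (c 1) = i (c 0)"
        using c by simp
      ultimately show ?thesis
        using i_code by auto
    qed
  qed
  have "z0 \<in> Z0"
    using z0 by (simp add: Z0_def path_component_of_refl)
  then show thesis
    using that[OF cov pc', of "code z0"] top i_code by auto
qed

section \<open>Fibre products of Peano coverings\<close>

text \<open>
  This is the only topology that can make \<open>f\<close> a Peano map while leaving the paths of \<open>A\<close> as they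
  are. It need not be finer than \<open>A\<close>: if all of \<open>B\<close> is one point, it only remembers the path
  components of \<open>A\<close>.
\<close>

definition Peano_refinement :: "'a topology \<Rightarrow> 'b topology \<Rightarrow> ('a \<Rightarrow> 'b) \<Rightarrow> 'a topology" where
  "Peano_refinement A B f = topology (arbitrary union_of
     (\<lambda>C. \<exists>U. openin B U \<and> C \<in> path_components_of (subtopology A {a \<in> topspace A. f a \<in> U})))"

lemma openin_Peano_refinement:
  "openin (Peano_refinement A B f) = arbitrary union_of
     (\<lambda>C. \<exists>U. openin B U \<and> C \<in> path_components_of (subtopology A {a \<in> topspace A. f a \<in> U}))"
  (is "_ = arbitrary union_of ?P")
proof -
  let ?K = "\<lambda>U. path_component_of_set (subtopology A {a \<in> topspace A. f a \<in> U})"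
  have "(arbitrary union_of ?P) (C \<inter> D)" if C: "?P C" and D: "?P D" for C D
    unfolding arbitrary_union_of_alt
  proof (intro ballI)
    fix a assume a: "a \<in> C \<inter> D"
    obtain U where U: "openin B U" "C \<in> path_components_of (subtopology A {a \<in> topspace A. f a \<in> U})"
      using C by blast
    obtain V where V: "openin B V" "D \<in> path_components_of (subtopology A {a \<in> topspace A. f a \<in> V})"
      using D by blast
    \<comment> \<open>Distinct path components of one preimage are disjoint, so \<open>C\<close> and \<open>D\<close> are the components of \<open>a\<close>.\<close>
    have CD: "C = ?K U a" "D = ?K V a" and aUV: "a \<in> topspace A" "f a \<in> U \<inter> V"
      using U(2) V(2) a unfolding path_components_of_def by (auto simp: path_component_of_equiv)
    have "?K (U \<inter> V) a \<subseteq> C \<inter> D"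
      unfolding CD by (auto intro: path_component_of_mono)
    moreover have "?P (?K (U \<inter> V) a)"
      using U(1) V(1) aUV unfolding path_components_of_def
      by (intro exI[of _ "U \<inter> V"]) auto
    moreover have "a \<in> ?K (U \<inter> V) a"
      using aUV by (simp add: path_component_of_refl)
    ultimately show "\<exists>E. ?P E \<and> a \<in> E \<and> E \<subseteq> C \<inter> D"
      by blast
  qed
  then have "istopology (arbitrary union_of ?P)"
    unfolding istopology_base_eq by blast
  then show ?thesis
    unfolding Peano_refinement_def by (rule topology_inverse')
qed

lemma openin_Peano_refinement_path_component:
  assumes "openin B U" "a \<in> topspace A" "f a \<in> U"
  shows "openin (Peano_refinement A B f)
    (path_component_of_set (subtopology A {a \<in> topspace A. f a \<in> U}) a)"
  unfolding openin_Peano_refinement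
  by (rule arbitrary_union_of_inc) (use assms in \<open>auto simp: path_components_of_def\<close>)

lemma topspace_Peano_refinement:
  assumes "f \<in> topspace A \<rightarrow> topspace B"
  shows "topspace (Peano_refinement A B f) = topspace A"
proof
  show "topspace (Peano_refinement A B f) \<subseteq> topspace A"
  proof
    fix a assume "a \<in> topspace (Peano_refinement A B f)"
    then have "(arbitrary union_of (\<lambda>C. \<exists>U. openin B U \<and>
        C \<in> path_components_of (subtopology A {a \<in> topspace A. f a \<in> U})))
        (topspace (Peano_refinement A B f))"
      by (metis openin_Peano_refinement openin_topspace)
    then obtain C U where "a \<in> C" "C \<in> path_components_of (subtopology A {a \<in> topspace A. f a \<in> U})"
      using \<open>a \<in> topspace (Peano_refinement A B f)\<close> unfolding arbitrary_union_of_alt by blast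
    then show "a \<in> topspace A"
      using path_components_of_subset by fastforce
  qed
  show "topspace A \<subseteq> topspace (Peano_refinement A B f)"
  proof
    fix a assume a: "a \<in> topspace A"
    then have "f a \<in> topspace B"
      using assms by auto
    then have "a \<in> path_component_of_set (subtopology A {a \<in> topspace A. f a \<in> topspace B}) a"
      using a by (simp add: path_component_of_refl)
    moreover have "path_component_of_set (subtopology A {a \<in> topspace A. f a \<in> topspace B}) a
        \<subseteq> topspace (Peano_refinement A B f)"
      by (rule openin_subset, rule openin_Peano_refinement_path_component)
        (use a \<open>f a \<in> topspace B\<close> in auto)
    ultimately show "a \<in> topspace (Peano_refinement A B f)"
      by (rule rev_subsetD)
  qed
qed

text \<open>
  Locally, a map out of a locally path-connected space moves within a single path component of
  any preimage of an open set.
\<close>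

lemma continuous_map_into_Peano_refinement:
  assumes D: "locally_path_connected_space D" and k: "continuous_map D A k"
    and f: "continuous_map A B f"
  shows "continuous_map D (Peano_refinement A B f) k"
proof (rule continuous_map_into_topology_base[OF openin_Peano_refinement])
  show "k x \<in> topspace (Peano_refinement A B f)" if "x \<in> topspace D" for x
    using that k f by (auto simp: topspace_Peano_refinement continuous_map_def Pi_iff)
  fix C assume "\<exists>U. openin B U \<and> C \<in> path_components_of (subtopology A {a \<in> topspace A. f a \<in> U})"
  then obtain U where U: "openin B U"
    and C: "C \<in> path_components_of (subtopology A {a \<in> topspace A. f a \<in> U})"
    by blast
  let ?V = "{x \<in> topspace D. f (k x) \<in> U}"
  have V: "openin D ?V"
    using openin_continuous_map_preimage[OF continuous_map_compose[OF k f] U] by simp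
  show "openin D {x \<in> topspace D. k x \<in> C}"
  proof (subst openin_subopen, intro ballI)
    fix x assume x: "x \<in> {x \<in> topspace D. k x \<in> C}"
    then have C_eq: "C = path_component_of_set (subtopology A {a \<in> topspace A. f a \<in> U}) (k x)"
      and fx: "f (k x) \<in> U"
      using C unfolding path_components_of_def by (auto simp: path_component_of_equiv)
    have "openin D (path_component_of_set (subtopology D ?V) x)"
      using D V x fx unfolding locally_path_connected_space_eq_open_path_component_of by auto
    moreover have "x \<in> path_component_of_set (subtopology D ?V) x"
      using x fx by (simp add: path_component_of_refl)
    moreover have "path_component_of_set (subtopology D ?V) x \<subseteq> {x \<in> topspace D. k x \<in> C}"
    proof clarify
      fix y assume y: "path_component_of (subtopology D ?V) x y"
      have "path_component_of (subtopology A {a \<in> topspace A. f a \<in> U}) (k x) (k y)"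
        by (rule path_component_of_subtopology_image[OF k y])
          (use k in \<open>auto simp: continuous_map_def Pi_iff\<close>)
      then show "y \<in> topspace D \<and> k y \<in> C"
        using path_component_in_topspace[OF y] by (simp add: C_eq)
    qed
    ultimately show "\<exists>T. openin D T \<and> x \<in> T \<and> T \<subseteq> {x \<in> topspace D. k x \<in> C}"
      by blast
  qed
qed

lemma continuous_map_Peano_refinement:
  assumes f: "continuous_map A B f"
  shows "continuous_map (Peano_refinement A B f) B f"
  unfolding continuous_map_def
proof (intro conjI allI impI)
  let ?T = "Peano_refinement A B f"
  have f': "f \<in> topspace A \<rightarrow> topspace B"
    using f by (simp add: continuous_map_funspace)
  then show "f \<in> topspace ?T \<rightarrow> topspace B"
    by (simp add: topspace_Peano_refinement)
  fix U assume U: "openin B U"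
  show "openin ?T {a \<in> topspace ?T. f a \<in> U}"
  proof (subst openin_subopen, intro ballI)
    fix a assume "a \<in> {a \<in> topspace ?T. f a \<in> U}"
    then have a: "a \<in> topspace A" "f a \<in> U"
      by (simp_all add: topspace_Peano_refinement[OF f'])
    let ?K = "path_component_of_set (subtopology A {a \<in> topspace A. f a \<in> U}) a"
    have "?K \<subseteq> {a \<in> topspace ?T. f a \<in> U}"
      using path_component_of_subset_topspace[of "subtopology A {a \<in> topspace A. f a \<in> U}" a]
      by (auto simp: topspace_Peano_refinement[OF f'])
    then show "\<exists>W. openin ?T W \<and> a \<in> W \<and> W \<subseteq> {a \<in> topspace ?T. f a \<in> U}"
      using openin_Peano_refinement_path_component[of B U a A f, OF U a] a
      by (intro exI[of _ ?K]) (simp add: path_component_of_refl)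
  qed
qed

text \<open>
  Intervals are locally path-connected, so paths for the old topology are paths for the new one.
  The hypothesis \<open>id\<close> gives the converse, so both topologies have the same path components, and the
  basis of the new topology is the required one.
\<close>

lemma Peano_map_Peano_refinement:
  assumes f: "continuous_map A B f" and id: "continuous_map (Peano_refinement A B f) A id"
  shows "Peano_map (Peano_refinement A B f) B f"
proof -
  let ?T = "Peano_refinement A B f"
  have "f \<in> topspace A \<rightarrow> topspace B"
    using f by (simp add: continuous_map_funspace)
  then have top: "topspace ?T = topspace A"
    by (rule topspace_Peano_refinement)
  have "pathin ?T c \<longleftrightarrow> pathin A c" for c
    using continuous_map_into_Peano_refinement[OF locally_path_connected_real_interval(1) _ f]
      continuous_map_compose[OF _ id] unfolding pathin_def id_comp by blast
  then have "path_component_of (subtopology ?T S) = path_component_of (subtopology A S)" for S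
    by (intro ext) (simp add: path_component_of_def pathin_subtopology)
  then have "path_components_of (subtopology ?T S) = path_components_of (subtopology A S)" for S
    unfolding path_components_of_def by (simp add: top)
  then show ?thesis
    unfolding Peano_map_def
    using continuous_map_Peano_refinement[OF f] by (simp add: top openin_Peano_refinement)
qed

definition fibre_product ::
    "'x topology \<Rightarrow> 'j set \<Rightarrow> ('j \<Rightarrow> 'z topology) \<Rightarrow> ('j \<Rightarrow> 'z \<Rightarrow> 'x) \<Rightarrow> ('x \<times> ('j \<Rightarrow> 'z)) topology" where
  "fibre_product X J Z q = subtopology (prod_topology X (product_topology Z J))
     {e. \<forall>j\<in>J. q j (snd e j) = fst e}"

lemma continuous_map_into_fibre_product:
  assumes "continuous_map D X (\<lambda>d. fst (k d))" "\<And>j. j \<in> J \<Longrightarrow> continuous_map D (Z j) (\<lambda>d. snd (k d) j)"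
    and "\<And>d. d \<in> topspace D \<Longrightarrow> snd (k d) \<in> extensional J"
    and "\<And>d j. d \<in> topspace D \<Longrightarrow> j \<in> J \<Longrightarrow> q j (snd (k d) j) = fst (k d)"
  shows "continuous_map D (fibre_product X J Z q) k"
proof -
  have "continuous_map D (product_topology Z J) (snd \<circ> k)"
    unfolding continuous_map_componentwise using assms(2,3) by auto
  moreover have "continuous_map D X (fst \<circ> k)"
    using assms(1) by (simp add: o_def)
  ultimately show ?thesis
    unfolding fibre_product_def continuous_map_in_subtopology continuous_map_pairwise
    using assms(4) by auto
qed

lemma continuous_map_fibre_product_fst: "continuous_map (fibre_product X J Z q) X fst"
  unfolding fibre_product_def by (intro continuous_map_from_subtopology continuous_map_fst)

lemma continuous_map_fibre_product_component:
  assumes "j \<in> J"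
  shows "continuous_map (fibre_product X J Z q) (Z j) (\<lambda>e. snd e j)"
  unfolding fibre_product_def
  by (intro continuous_map_from_subtopology
      continuous_map_compose[OF continuous_map_snd continuous_map_product_projection[OF assms], unfolded o_def])

lemma locally_path_connected_cube_times_interval:
  "locally_path_connected_space (prod_topology (cube n) (top_of_set {0..1::real}))"
  unfolding cube_def locally_path_connected_space_prod_topology
    locally_path_connected_space_product_topology
  using locally_path_connected_real_interval(1)[of 0 1] by auto

text \<open>
  The coordinates stay continuous for the refined topology because the open sets of each factor are
  themselves unions of path components of preimages of open subsets of \<open>X\<close>, and a coordinate maps
  path components of preimages into such path components. So the refined topology is finer than
  that of the fibre product. Lifting of homotopies and triviality of paths in
  fibres are then verified coordinate by coordinate. The first component in \<open>X\<close> keeps the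
  projection meaningful when \<open>J\<close> is empty.
\<close>

lemma
  fixes X :: "'x topology" and Z :: "'j \<Rightarrow> 'z topology"
  assumes q: "\<And>j. j \<in> J \<Longrightarrow> Peano_covering_map (Z j) X (q j)"
  defines "T \<equiv> Peano_refinement (fibre_product X J Z q) X fst"
  shows continuous_map_refined_fibre_product_component:
      "\<And>j. j \<in> J \<Longrightarrow> continuous_map T (Z j) (\<lambda>e. snd e j)"
    and Peano_covering_map_refined_fibre_product: "Peano_covering_map T X fst"
    and topspace_refined_fibre_product: "topspace T = topspace (fibre_product X J Z q)"
proof -
  let ?E = "fibre_product X J Z q"
  note cfst = continuous_map_fibre_product_fst[of X J Z q]
  show top: "topspace T = topspace ?E"
    unfolding T_def using cfst by (intro topspace_Peano_refinement) (simp add: continuous_map_funspace)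
  have E_proj: "q j (snd e j) = fst e" if "e \<in> topspace ?E" "j \<in> J" for e j
    using that by (simp add: fibre_product_def)
  have cT: "continuous_map T X fst"
    unfolding T_def by (rule continuous_map_Peano_refinement[OF cfst])
  show comp: "continuous_map T (Z j) (\<lambda>e. snd e j)" if j: "j \<in> J" for j
    unfolding continuous_map_def
  proof (intro conjI allI impI)
    note cj = continuous_map_fibre_product_component[OF j, of X Z q]
    show "(\<lambda>e. snd e j) \<in> topspace T \<rightarrow> topspace (Z j)"
      using cj by (simp add: top continuous_map_funspace)
    fix W assume W: "openin (Z j) W"
    show "openin T {e \<in> topspace T. snd e j \<in> W}"
    proof (subst openin_subopen, intro ballI)
      fix e assume "e \<in> {e \<in> topspace T. snd e j \<in> W}"
      then have e: "e \<in> topspace ?E" "snd e j \<in> W"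
        by (simp_all add: top)
      obtain U where U: "openin X U" "q j (snd e j) \<in> U" and UW:
        "path_component_of_set (subtopology (Z j) {z \<in> topspace (Z j). q j z \<in> U}) (snd e j) \<subseteq> W"
        by (rule Peano_covering_map_basis[OF q[OF j] W e(2)])
      have eU: "fst e \<in> U"
        using U(2) E_proj[OF e(1) j] by simp
      let ?K = "path_component_of_set (subtopology ?E {e \<in> topspace ?E. fst e \<in> U}) e"
      have "?K \<subseteq> {e \<in> topspace T. snd e j \<in> W}"
      proof clarify
        fix x y assume xy: "path_component_of (subtopology ?E {e \<in> topspace ?E. fst e \<in> U}) e (x, y)"
        have "path_component_of (subtopology (Z j) {z \<in> topspace (Z j). q j z \<in> U})
            (snd e j) (snd (x, y) j)"
          by (rule path_component_of_subtopology_image[OF cj xy])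
            (use cj E_proj j in \<open>auto simp: continuous_map_def Pi_iff\<close>)
        then show "(x, y) \<in> topspace T \<and> snd (x, y) j \<in> W"
          using UW path_component_in_topspace[OF xy] by (auto simp: top)
      qed
      moreover have "openin T ?K"
        unfolding T_def by (rule openin_Peano_refinement_path_component[of X U e ?E fst, OF U(1) e(1) eU])
      moreover have "e \<in> ?K"
        using e eU by (simp add: path_component_of_refl)
      ultimately show "\<exists>V. openin T V \<and> e \<in> V \<and> V \<subseteq> {e \<in> topspace T. snd e j \<in> W}"
        by blast
    qed
  qed
  have ext: "snd e \<in> extensional J" if "e \<in> topspace ?E" for e
    using that by (auto simp: fibre_product_def PiE_def)
  have id: "continuous_map T ?E id"
    by (rule continuous_map_into_fibre_product) (use cT comp E_proj ext top in auto)
  show "Peano_covering_map T X fst"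
    unfolding Peano_covering_map_iff
  proof (intro conjI allI impI)
    show "Peano_map T X fst"
      using id unfolding T_def by (intro Peano_map_Peano_refinement cfst)
    show "Serre_fibration T X fst"
    proof (rule Serre_fibrationI[OF cT])
      let ?I = "top_of_set {0..1::real}"
      fix n g and H :: "(nat \<Rightarrow> real) \<times> real \<Rightarrow> 'x"
      assume H: "continuous_map (prod_topology (cube n) ?I) X H"
        and g: "continuous_map (cube n) T g" "\<And>s. s \<in> topspace (cube n) \<Longrightarrow> fst (g s) = H (s, 0)"
      have g_mem: "g s \<in> topspace ?E" if "s \<in> topspace (cube n)" for s
        using g(1) that by (auto simp: continuous_map_def Pi_iff top)
      have "\<exists>K. continuous_map (prod_topology (cube n) ?I) (Z j) K \<and>
          (\<forall>s\<in>topspace (cube n). K (s, 0) = snd (g s) j) \<and>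
          (\<forall>s\<in>topspace (cube n). \<forall>t\<in>{0..1}. q j (K (s, t)) = H (s, t))" if j: "j \<in> J" for j
      proof -
        have gj: "continuous_map (cube n) (Z j) (\<lambda>s. snd (g s) j)"
          using continuous_map_compose[OF g(1) comp[OF j]] by (simp add: o_def)
        have "q j (snd (g s) j) = H (s, 0)" if "s \<in> topspace (cube n)" for s
          using E_proj[OF g_mem[OF that] j] g(2)[OF that] by simp
        then show ?thesis
          using q[OF j] H gj unfolding Peano_covering_map_def Serre_fibration_def by blast
      qed
      then obtain K where K: "\<And>j. j \<in> J \<Longrightarrow> continuous_map (prod_topology (cube n) ?I) (Z j) (K j)"
        "\<And>j s. j \<in> J \<Longrightarrow> s \<in> topspace (cube n) \<Longrightarrow> K j (s, 0) = snd (g s) j"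
        "\<And>j s t. j \<in> J \<Longrightarrow> s \<in> topspace (cube n) \<Longrightarrow> t \<in> {0..1} \<Longrightarrow> q j (K j (s, t)) = H (s, t)"
        by metis
      define L where "L = (\<lambda>z. (H z, \<lambda>j\<in>J. K j z))"
      have "continuous_map (prod_topology (cube n) ?I) ?E L"
        by (rule continuous_map_into_fibre_product) (use H K in \<open>auto simp: L_def\<close>)
      then have "continuous_map (prod_topology (cube n) ?I) T L"
        unfolding T_def
        by (intro continuous_map_into_Peano_refinement[OF locally_path_connected_cube_times_interval _ cfst])
      moreover have "L (s, 0) = g s" if s: "s \<in> topspace (cube n)" for s
      proof (rule prod_eqI)
        show "fst (L (s, 0)) = fst (g s)"
          using g(2)[OF s] by (simp add: L_def)
        show "snd (L (s, 0)) = snd (g s)"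
          using K(2)[OF _ s] ext[OF g_mem[OF s]] by (auto simp: L_def extensional_def restrict_def)
      qed
      ultimately show "\<exists>K. continuous_map (prod_topology (cube n) ?I) T K \<and>
          (\<forall>s\<in>topspace (cube n). K (s, 0) = g s) \<and>
          (\<forall>s\<in>topspace (cube n). \<forall>t\<in>{0..1}. fst (K (s, t)) = H (s, t))"
        by (intro exI[of _ L]) (simp add: L_def)
    qed
    show "c 1 = c 0" if c: "pathin T c \<and> (\<forall>t \<in> {0..1}. fst (c t) = b)" for c b
    proof (rule prod_eqI)
      have c_mem: "c t \<in> topspace ?E" if "t \<in> {0..1}" for t
        using c that path_image_subset_topspace[of T c] top by (auto simp: Pi_iff)
      show "fst (c 1) = fst (c 0)"
        using c by simp
      have "snd (c 1) j = snd (c 0) j" if j: "j \<in> J" for j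
      proof -
        have "pathin (Z j) (\<lambda>t. snd (c t) j)"
          using pathin_compose[OF _ comp[OF j], of c] c by (simp add: o_def)
        then show ?thesis
          by (rule Peano_covering_map_fiber_path[OF q[OF j], where b = b])
            (use c E_proj[OF c_mem j] in auto)
      qed
      then show "snd (c 1) = snd (c 0)"
        using ext[OF c_mem[of 0]] ext[OF c_mem[of 1]] by (intro extensionalityI[of _ J]) auto
    qed
  qed
qed

section \<open>The fundamental group\<close>

abbreviation loop_homotopic :: "'a topology \<Rightarrow> 'a \<Rightarrow> (real \<Rightarrow> 'a) \<Rightarrow> (real \<Rightarrow> 'a) \<Rightarrow> bool" where
  "loop_homotopic X x \<equiv> homotopic_with (\<lambda>k. k 0 = x \<and> k 1 = x) (top_of_set {0..1}) X"

lemma loop_homotopic_refl: "loop_homotopic X x g g \<longleftrightarrow> g \<in> loops_at X x"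
  by (auto simp: loops_at_def pathin_def)

lemma loop_class_cong_homotopic:
  assumes "loop_homotopic X x g h"
  shows "loop_class X x g = loop_class X x h"
  unfolding loop_class_def
  using assms homotopic_with_trans homotopic_with_symD by blast

lemma loop_class_cong:
  assumes "g \<in> loops_at X x" "\<And>t. t \<in> {0..1} \<Longrightarrow> g t = h t"
  shows "loop_class X x g = loop_class X x h"
proof (rule loop_class_cong_homotopic, rule homotopic_with_equal)
  show "h 0 = x \<and> h 1 = x"
    using assms(1) assms(2)[of 0] assms(2)[of 1] by (simp add: loops_at_def)
qed (use assms in \<open>auto simp: loops_at_def pathin_def\<close>)

lemma loop_homotopic_loop_concat:
  assumes "loop_homotopic X x g g'" "loop_homotopic X x h h'"
  shows "loop_homotopic X x (loop_concat g h) (loop_concat g' h')"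
proof -
  let ?I = "top_of_set {0..1::real}"
  obtain k where k: "continuous_map (prod_topology ?I ?I) X k" "\<And>t. k (0, t) = g t"
    "\<And>t. k (1, t) = g' t" "\<And>s. s \<in> {0..1} \<Longrightarrow> k (s, 0) = x \<and> k (s, 1) = x"
    using assms(1) unfolding homotopic_with_def by auto
  obtain l where l: "continuous_map (prod_topology ?I ?I) X l" "\<And>t. l (0, t) = h t"
    "\<And>t. l (1, t) = h' t" "\<And>s. s \<in> {0..1} \<Longrightarrow> l (s, 0) = x \<and> l (s, 1) = x"
    using assms(2) unfolding homotopic_with_def by auto
  show ?thesis
    unfolding homotopic_with_def
  proof (intro exI conjI)
    show "continuous_map (prod_topology ?I ?I) X
        (\<lambda>z. loop_concat (\<lambda>t. k (fst z, t)) (\<lambda>t. l (fst z, t)) (snd z))"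
      by (rule continuous_map_loop_concat[OF k(1) l(1)]) (use k(4) l(4) in simp)
  qed (use k(2-) l(2-) in auto)
qed

text \<open>
  The interval is convex, so \<open>\<phi>\<close> deforms linearly to \<open>\<psi>\<close>. All laws of the fundamental group are
  instances, as both sides of each law are reparametrizations of one path.
\<close>

lemma loop_homotopic_reparametrize:
  fixes \<phi> \<psi> :: "real \<Rightarrow> real"
  assumes g: "pathin X g"
    and \<phi>: "continuous_on {0..1} \<phi>" "\<phi> ` {0..1} \<subseteq> {0..1}"
    and \<psi>: "continuous_on {0..1} \<psi>" "\<psi> ` {0..1} \<subseteq> {0..1}"
    and ends: "\<phi> 0 = \<psi> 0" "\<phi> 1 = \<psi> 1" "g (\<phi> 0) = x" "g (\<phi> 1) = x"
  shows "loop_homotopic X x (\<lambda>t. g (\<phi> t)) (\<lambda>t. g (\<psi> t))"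
proof -
  let ?I = "top_of_set {0..1::real}"
  define \<mu> where "\<mu> = (\<lambda>z. (1 - fst z) * \<phi> (snd z) + fst z * \<psi> (snd z))"
  have \<mu>_mem: "\<mu> (s, t) \<in> {0..1}" if "s \<in> {0..1}" "t \<in> {0..1}" for s t
  proof -
    have "\<phi> t \<in> {0..1}" "\<psi> t \<in> {0..1}"
      using \<phi>(2) \<psi>(2) that(2) by blast+
    then have "(1 - s) *\<^sub>R \<phi> t + s *\<^sub>R \<psi> t \<in> {0..1}"
      using that(1) by (intro convexD) auto
    then show ?thesis
      by (simp add: \<mu>_def)
  qed
  have snd: "continuous_on ({0..1} \<times> {0..1}) snd" "snd ` ({0..1::real} \<times> {0..1::real}) \<subseteq> {0..1}"
    by (auto intro: continuous_intros)
  note continuous_on_compose2[OF \<phi>(1) snd] continuous_on_compose2[OF \<psi>(1) snd]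
  then have "continuous_on ({0..1} \<times> {0..1}) \<mu>"
    unfolding \<mu>_def by (intro continuous_intros)
  then have "continuous_map (prod_topology ?I ?I) ?I \<mu>"
    using \<mu>_mem by auto
  then have "continuous_map (prod_topology ?I ?I) X (g \<circ> \<mu>)"
    using g unfolding pathin_def by (rule continuous_map_compose)
  moreover have "\<mu> (s, 0) = \<phi> 0" "\<mu> (s, 1) = \<phi> 1" for s
    by (simp_all add: \<mu>_def ends(1,2)[symmetric] algebra_simps)
  ultimately show ?thesis
    unfolding homotopic_with_def
    using ends by (intro exI[of _ "g \<circ> \<mu>"] conjI allI ballI) (simp_all, simp_all add: \<mu>_def)
qed

lemma loops_at_iff: "g \<in> loops_at X x \<longleftrightarrow> pathin X g \<and> g 0 = x \<and> g 1 = x"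
  by (simp add: loops_at_def)

lemma loop_concat_in_loops_at:
  "g \<in> loops_at X x \<Longrightarrow> h \<in> loops_at X x \<Longrightarrow> loop_concat g h \<in> loops_at X x"
  by (simp add: loops_at_iff pathin_loop_concat)

lemma reverse_in_loops_at: "g \<in> loops_at X x \<Longrightarrow> (\<lambda>t. g (1 - t)) \<in> loops_at X x"
  by (simp add: loops_at_iff pathin_reverse)

lemma UN_constant_value:
  assumes "a \<in> A" "\<And>b. b \<in> A \<Longrightarrow> F b = C"
  shows "(\<Union>b\<in>A. F b) = C"
  using assms by auto

lemma fundamental_group_mult:
  assumes "g \<in> loops_at X x" "h \<in> loops_at X x"
  shows "loop_class X x g \<otimes>\<^bsub>fundamental_group X x\<^esub> loop_class X x h = loop_class X x (loop_concat g h)"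
proof -
  have *: "loop_class X x (loop_concat g' h') = loop_class X x (loop_concat g h)"
    if "g' \<in> loop_class X x g" "h' \<in> loop_class X x h" for g' h'
    using that loop_class_cong_homotopic[OF loop_homotopic_loop_concat, of x X g g' h h']
    by (simp add: loop_class_def)
  have "g \<in> loop_class X x g" "h \<in> loop_class X x h"
    using assms by (simp_all only: loop_class_def mem_Collect_eq loop_homotopic_refl)
  then have "(\<Union>g'\<in>loop_class X x g. \<Union>h'\<in>loop_class X x h. loop_class X x (loop_concat g' h'))
      = loop_class X x (loop_concat g h)"
    by (intro UN_constant_value *)
  then show ?thesis
    by (simp add: fundamental_group_def)
qed

lemma fundamental_group_map_class:
  assumes f: "continuous_map A B f" and g: "g \<in> loops_at A a"
  shows "fundamental_group_map B (f a) f (loop_class A a g) = loop_class B (f a) (f \<circ> g)"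
proof -
  have *: "loop_class B (f a) (f \<circ> g') = loop_class B (f a) (f \<circ> g)" if "g' \<in> loop_class A a g" for g'
  proof (rule sym, rule loop_class_cong_homotopic)
    show "loop_homotopic B (f a) (f \<circ> g) (f \<circ> g')"
    proof (rule homotopic_with_compose_continuous_map_left[OF _ f])
      show "loop_homotopic A a g g'"
        using that by (simp only: loop_class_def mem_Collect_eq)
    qed simp
  qed
  have "g \<in> loop_class A a g"
    using g by (simp only: loop_class_def mem_Collect_eq loop_homotopic_refl)
  then show ?thesis
    unfolding fundamental_group_map_def by (rule UN_constant_value) (rule *)
qed

lemma carrier_fundamental_group: "carrier (fundamental_group X x) = loop_class X x ` loops_at X x"
  by (simp add: fundamental_group_def)

lemma one_fundamental_group: "\<one>\<^bsub>fundamental_group X x\<^esub> = loop_class X x (\<lambda>_. x)"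
  by (simp add: fundamental_group_def)

lemma fundamental_group_reverse:
  assumes g: "g \<in> loops_at X x"
  shows "loop_class X x (\<lambda>t. g (1 - t)) \<otimes>\<^bsub>fundamental_group X x\<^esub> loop_class X x g
    = \<one>\<^bsub>fundamental_group X x\<^esub>"
proof -
  \<comment> \<open>Backwards from 1 to 0 and forwards again is a deformation of staying at 1.\<close>
  have "loop_homotopic X x (\<lambda>t. g \<bar>1 - 2 * t\<bar>) (\<lambda>t. g 1)"
    by (rule loop_homotopic_reparametrize)
      (use g in \<open>auto simp: loops_at_iff intro!: continuous_intros\<close>)
  moreover have "(\<lambda>t. g \<bar>1 - 2 * t\<bar>) = loop_concat (\<lambda>t. g (1 - t)) g"
    by (auto simp: loop_concat_def)
  ultimately have "loop_class X x (loop_concat (\<lambda>t. g (1 - t)) g) = loop_class X x (\<lambda>_. x)"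
    using g loop_class_cong_homotopic by (fastforce simp: loops_at_iff)
  then show ?thesis
    using g by (simp add: fundamental_group_mult reverse_in_loops_at one_fundamental_group)
qed

lemma group_fundamental_group:
  assumes x: "x \<in> topspace X"
  shows "group (fundamental_group X x)"
proof (rule groupI)
  let ?G = "fundamental_group X x"
  note carrier = carrier_fundamental_group[of X x]
  have const: "(\<lambda>_. x) \<in> loops_at X x"
    using x by (simp add: loops_at_iff)
  show "a \<otimes>\<^bsub>?G\<^esub> b \<in> carrier ?G" if "a \<in> carrier ?G" "b \<in> carrier ?G" for a b
    using that by (auto simp: carrier fundamental_group_mult intro: loop_concat_in_loops_at)
  show "\<one>\<^bsub>?G\<^esub> \<in> carrier ?G"
    using const by (simp add: carrier one_fundamental_group)
  show "\<one>\<^bsub>?G\<^esub> \<otimes>\<^bsub>?G\<^esub> a = a" if a: "a \<in> carrier ?G" for a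
  proof -
    obtain g where g: "g \<in> loops_at X x" "a = loop_class X x g"
      using a by (auto simp: carrier)
    have "loop_homotopic X x (\<lambda>t. g (max 0 (2 * t - 1))) (\<lambda>t. g t)"
      by (rule loop_homotopic_reparametrize)
        (use g in \<open>auto simp: loops_at_iff intro!: continuous_intros\<close>)
    moreover have "(\<lambda>t. g (max 0 (2 * t - 1))) = loop_concat (\<lambda>_. x) g"
      using g by (auto simp: loop_concat_def loops_at_iff)
    ultimately show ?thesis
      using g const by (auto simp: one_fundamental_group fundamental_group_mult
          dest: loop_class_cong_homotopic)
  qed
  show "\<exists>b\<in>carrier ?G. b \<otimes>\<^bsub>?G\<^esub> a = \<one>\<^bsub>?G\<^esub>" if a: "a \<in> carrier ?G" for a
  proof -
    obtain g where g: "g \<in> loops_at X x" "a = loop_class X x g"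
      using a by (auto simp: carrier)
    then have "loop_class X x (\<lambda>t. g (1 - t)) \<in> carrier ?G"
      using reverse_in_loops_at[OF g(1)] by (simp add: carrier)
    then show ?thesis
      using fundamental_group_reverse[OF g(1)] unfolding g(2) by (rule rev_bexI)
  qed
  show "a \<otimes>\<^bsub>?G\<^esub> b \<otimes>\<^bsub>?G\<^esub> c = a \<otimes>\<^bsub>?G\<^esub> (b \<otimes>\<^bsub>?G\<^esub> c)"
    if abc: "a \<in> carrier ?G" "b \<in> carrier ?G" "c \<in> carrier ?G" for a b c
  proof -
    obtain f g h where f: "f \<in> loops_at X x" "a = loop_class X x f"
      and g: "g \<in> loops_at X x" "b = loop_class X x g"
      and h: "h \<in> loops_at X x" "c = loop_class X x h"
      using abc by (auto simp: carrier)
    define k where "k = loop_concat f (loop_concat g h)"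
    have k: "k \<in> loops_at X x"
      unfolding k_def by (intro loop_concat_in_loops_at f g h)
    \<comment> \<open>The slopes 2, 1, 1/2 turn the break points 1/4, 1/2 into 1/2, 3/4; being concave, the function is a minimum.\<close>
    have "loop_homotopic X x (\<lambda>t. k (min (2 * t) (min (t + 1/4) ((t + 1) / 2)))) (\<lambda>t. k t)"
    proof (rule loop_homotopic_reparametrize)
      show "continuous_on {0..1} (\<lambda>t. min (2 * t) (min (t + 1/4) ((t + 1) / 2)) :: real)"
        by (intro continuous_intros) auto
      show "(\<lambda>t. min (2 * t) (min (t + 1/4) ((t + 1) / 2)) :: real) ` {0..1} \<subseteq> {0..1}"
        by (auto simp: min_le_iff_disj)
      show "k (min (2 * 0) (min (0 + 1/4) ((0 + 1) / 2))) = x"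
        "k (min (2 * 1) (min (1 + 1/4) ((1 + 1) / 2))) = x"
        using k by (simp_all add: loops_at_iff)
    qed (use k in \<open>simp_all add: loops_at_iff\<close>)
    moreover have "(\<lambda>t. k (min (2 * t) (min (t + 1/4) ((t + 1) / 2))))
        = loop_concat (loop_concat f g) h"
    proof
      fix t :: real
      consider "t \<le> 1/4" | "1/4 < t" "t \<le> 1/2" | "1/2 < t" by linarith
      then show "k (min (2 * t) (min (t + 1/4) ((t + 1) / 2))) = loop_concat (loop_concat f g) h t"
      proof cases
        case 1
        then have "min (2 * t) (min (t + 1/4) ((t + 1) / 2)) = 2 * t" by auto
        then show ?thesis using 1 by (simp add: k_def loop_concat_def)
      next
        case 2
        then have "min (2 * t) (min (t + 1/4) ((t + 1) / 2)) = t + 1/4" by auto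
        moreover have "2 * (2 * (t + 1/4) - 1) = 2 * (2 * t) - 1" by simp
        ultimately show ?thesis using 2 unfolding k_def loop_concat_def by auto
      next
        case 3
        then have "min (2 * t) (min (t + 1/4) ((t + 1) / 2)) = (t + 1) / 2" by auto
        moreover have "2 * ((t + 1) / 2) - 1 = t" by (simp add: field_simps)
        ultimately show ?thesis using 3 by (simp add: k_def loop_concat_def)
      qed
    qed
    ultimately show ?thesis
      using f g h k unfolding k_def
      by (auto simp: fundamental_group_mult loop_concat_in_loops_at dest: loop_class_cong_homotopic)
  qed
qed

lemma inv_fundamental_group:
  assumes x: "x \<in> topspace X" and g: "g \<in> loops_at X x"
  shows "inv\<^bsub>fundamental_group X x\<^esub> loop_class X x g = loop_class X x (\<lambda>t. g (1 - t))"
  using fundamental_group_reverse[OF g] g reverse_in_loops_at[OF g]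
  by (intro group.inv_equality[OF group_fundamental_group[OF x]])
    (simp_all add: carrier_fundamental_group)

lemma loop_concat_compose: "f \<circ> loop_concat g h = loop_concat (f \<circ> g) (f \<circ> h)"
  by (auto simp: loop_concat_def)

lemma compose_in_loops_at:
  "continuous_map A B f \<Longrightarrow> g \<in> loops_at A a \<Longrightarrow> f \<circ> g \<in> loops_at B (f a)"
  by (auto simp: loops_at_iff intro: pathin_compose)

text \<open>
  To conjugate by \<open>m\<close>, lift \<open>m\<close> to a path \<open>c\<close> from \<open>y0\<close> and transport \<open>l\<close> to the end point of \<open>c\<close> by a
  map \<open>r\<close> over \<open>X\<close>, so that \<open>r \<circ> l\<close> and \<open>l\<close> have the same projection.
\<close>

lemma normal_image_if_transitive_deck_maps:
  assumes p: "Peano_covering_map Y X p" and y0: "y0 \<in> topspace Y"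
    and deck: "\<And>y1. y1 \<in> topspace Y \<Longrightarrow> p y1 = p y0 \<Longrightarrow>
      \<exists>r. continuous_map Y Y r \<and> (\<forall>y \<in> topspace Y. p (r y) = p y) \<and> r y0 = y1"
  shows "fundamental_group_map X (p y0) p ` carrier (fundamental_group Y y0)
    \<lhd> fundamental_group X (p y0)"
proof -
  let ?x = "p y0" and ?G = "fundamental_group X (p y0)"
  note cp = Peano_covering_map_continuous[OF p]
  define N where "N = {loop_class X ?x (p \<circ> l) |l. l \<in> loops_at Y y0}"
  have N: "fundamental_group_map X ?x p ` carrier (fundamental_group Y y0) = N"
    unfolding N_def carrier_fundamental_group
    using fundamental_group_map_class[OF cp] by (auto simp: image_image)
  have x: "?x \<in> topspace X"
    using cp y0 by (auto simp: continuous_map_def Pi_iff)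
  interpret group ?G
    by (rule group_fundamental_group[OF x])
  note pl = compose_in_loops_at[OF cp]
  have "subgroup N ?G"
  proof (rule subgroupI)
    show "N \<subseteq> carrier ?G"
      using pl unfolding N_def carrier_fundamental_group by blast
    show "N \<noteq> {}"
      using y0 unfolding N_def by (auto simp: loops_at_iff intro: exI[of _ "\<lambda>_. y0"])
    show "inv\<^bsub>?G\<^esub> a \<in> N" if a: "a \<in> N" for a
    proof -
      obtain l where l: "l \<in> loops_at Y y0" "a = loop_class X ?x (p \<circ> l)"
        using a unfolding N_def by blast
      have "inv\<^bsub>?G\<^esub> a = loop_class X ?x (p \<circ> (\<lambda>t. l (1 - t)))"
        using inv_fundamental_group[OF x pl[OF l(1)]] by (simp add: l(2) o_def)
      then show ?thesis
        unfolding N_def using reverse_in_loops_at[OF l(1)] by blast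
    qed
    show "a \<otimes>\<^bsub>?G\<^esub> b \<in> N" if ab: "a \<in> N" "b \<in> N" for a b
    proof -
      obtain l m where l: "l \<in> loops_at Y y0" "a = loop_class X ?x (p \<circ> l)"
        and m: "m \<in> loops_at Y y0" "b = loop_class X ?x (p \<circ> m)"
        using ab unfolding N_def by blast
      have "a \<otimes>\<^bsub>?G\<^esub> b = loop_class X ?x (p \<circ> loop_concat l m)"
        using l m pl by (simp add: fundamental_group_mult loop_concat_compose)
      then show ?thesis
        unfolding N_def using loop_concat_in_loops_at[OF l(1) m(1)] by blast
    qed
  qed
  moreover have "a \<otimes>\<^bsub>?G\<^esub> b \<otimes>\<^bsub>?G\<^esub> inv\<^bsub>?G\<^esub> a \<in> N" if a: "a \<in> carrier ?G" and b: "b \<in> N" for a b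
  proof -
    obtain m where m: "m \<in> loops_at X ?x" "a = loop_class X ?x m"
      using a by (auto simp: carrier_fundamental_group)
    obtain l where l: "l \<in> loops_at Y y0" "b = loop_class X ?x (p \<circ> l)"
      using b unfolding N_def by blast
    obtain c where c: "pathin Y c" "c 0 = y0" "\<And>t. t \<in> {0..1} \<Longrightarrow> p (c t) = m t"
      using path_lifting[OF p, of m y0] m(1) y0 by (auto simp: loops_at_iff)
    have "c 1 \<in> topspace Y" "p (c 1) = p y0"
      using c m(1) path_finish_in_topspace[of Y c] by (auto simp: loops_at_iff)
    then obtain r where r: "continuous_map Y Y r" "\<And>y. y \<in> topspace Y \<Longrightarrow> p (r y) = p y" "r y0 = c 1"
      using deck by blast
    define k where "k = loop_concat (loop_concat c (r \<circ> l)) (\<lambda>t. c (1 - t))"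
    have rl: "pathin Y (r \<circ> l)" "(r \<circ> l) 0 = c 1" "(r \<circ> l) 1 = c 1"
      using compose_in_loops_at[OF r(1) l(1)] r(3) by (auto simp: loops_at_iff)
    have k: "k \<in> loops_at Y y0"
      using c(1,2) rl by (simp add: k_def loops_at_iff pathin_loop_concat pathin_reverse)
    have "p ((r \<circ> l) t) = (p \<circ> l) t" if "t \<in> {0..1}" for t
      using l(1) that path_image_subset_topspace[of Y l] r(2)[of "l t"] by (auto simp: loops_at_iff Pi_iff)
    then have "(p \<circ> k) t = loop_concat (loop_concat m (p \<circ> l)) (\<lambda>t. m (1 - t)) t" if "t \<in> {0..1}" for t
      using that c(3) by (auto simp: k_def loop_concat_def)
    then have "loop_class X ?x (p \<circ> k)
        = loop_class X ?x (loop_concat (loop_concat m (p \<circ> l)) (\<lambda>t. m (1 - t)))"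
      by (intro loop_class_cong pl[OF k])
    also have "\<dots> = a \<otimes>\<^bsub>?G\<^esub> b \<otimes>\<^bsub>?G\<^esub> inv\<^bsub>?G\<^esub> a"
      using m l pl[OF l(1)]
      by (simp add: fundamental_group_mult inv_fundamental_group[OF x] loop_concat_in_loops_at
          reverse_in_loops_at)
    finally show ?thesis
      unfolding N_def using k by blast
  qed
  ultimately show ?thesis
    unfolding N normal_inv_iff by blast
qed

section \<open>The universal Peano covering map\<close>

lemma exists_universal_Peano_covering_map:
  fixes X :: "'x topology"
  assumes X: "path_connected_space X" "topspace X \<noteq> {}"
  obtains Y :: "'x covering_point topology" and p
  where "topspace Y \<noteq> {}" "universal_Peano_covering_map TYPE('x covering_point) Y X p"
proof -
  obtain x0 where x0: "x0 \<in> topspace X"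
    using X(2) by blast
  define J :: "('x covering_point topology \<times> ('x covering_point \<Rightarrow> 'x) \<times> 'x covering_point) set"
    where "J = {(Z, q, z). Peano_covering_map Z X q \<and> z \<in> topspace Z \<and> q z = x0}"
  have J: "Peano_covering_map (fst j) X (fst (snd j))" if "j \<in> J" for j
    using that by (auto simp: J_def)
  define E where "E = fibre_product X J fst (\<lambda>j. fst (snd j))"
  define T where "T = Peano_refinement E X fst"
  have T: "Peano_covering_map T X fst"
    unfolding T_def E_def by (rule Peano_covering_map_refined_fibre_product[OF J])
  have T_top: "topspace T = topspace E"
    unfolding T_def E_def by (rule topspace_refined_fibre_product[OF J])
  have T_comp: "continuous_map T (fst j) (\<lambda>e. snd e j)" if "j \<in> J" for j
    unfolding T_def E_def by (rule continuous_map_refined_fibre_product_component[OF J that])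
  define e0 where "e0 = (x0, \<lambda>j\<in>J. snd (snd j))"
  have "e0 \<in> topspace T"
    using x0 unfolding T_top E_def fibre_product_def e0_def by (auto simp: J_def)
  from path_component_copy[OF T this]
  obtain Y :: "'x covering_point topology" and i and yb where
    i: "Peano_covering_map Y T i" and Y: "path_connected_space Y" "yb \<in> topspace Y" "i yb = e0" .
  define p where "p = fst \<circ> i"
  have p: "Peano_covering_map Y X p"
    unfolding p_def by (rule Peano_covering_map_compose[OF i T])
  have lift: "\<exists>r. Peano_covering_map Y Z r \<and> (\<forall>y\<in>topspace Y. q (r y) = p y) \<and> r y0 = z0"
    if q: "Peano_covering_map Z X q" and z0: "z0 \<in> topspace Z" and y0: "y0 \<in> topspace Y"
      and eq: "q z0 = p y0"
    for Z :: "'x covering_point topology" and q z0 y0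
  proof -
    obtain c where c: "pathin Y c" "c 0 = yb" "c 1 = y0"
      using Y y0 unfolding path_connected_space_def by blast
    \<comment> \<open>The index of the coordinate to use is found by moving \<open>z0\<close> back over the base point.\<close>
    have pc: "pathin X (p \<circ> c)"
      using pathin_compose[OF c(1) Peano_covering_map_continuous[OF p]] .
    have "q z0 = (p \<circ> c) (1 - 0)"
      using eq c(3) by simp
    then obtain d where d: "pathin Z d" "d 0 = z0"
      "\<And>t. t \<in> {0..1} \<Longrightarrow> q (d t) = (p \<circ> c) (1 - t)"
      using path_lifting[OF q pathin_reverse[OF pc] z0] by blast
    define j where "j = (Z, q, d 1)"
    have "q (d 1) = x0"
      using d(3)[of 1] c(2) Y(3) by (simp add: p_def e0_def)
    then have j: "j \<in> J"
      using q path_finish_in_topspace[OF d(1)] by (simp add: J_def j_def)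
    define r where "r = (\<lambda>e. snd e j) \<circ> i"
    have r: "continuous_map Y Z r"
      using continuous_map_compose[OF Peano_covering_map_continuous[OF i] T_comp[OF j]]
      by (simp add: r_def j_def)
    have qr: "q (r y) = p y" if y: "y \<in> topspace Y" for y
    proof -
      have "i y \<in> topspace E"
        using Peano_covering_map_continuous[OF i] y T_top by (auto simp: continuous_map_def Pi_iff)
      then have "fst (snd j) (snd (i y) j) = fst (i y)"
        using j unfolding E_def fibre_product_def by auto
      then show ?thesis
        by (simp add: r_def p_def j_def)
    qed
    have "(r \<circ> c) 1 = (\<lambda>t. d (1 - t)) 1"
    proof (rule unique_lift_end[OF q, of "r \<circ> c" "\<lambda>t. d (1 - t)"])
      show "pathin Z (r \<circ> c)" "pathin Z (\<lambda>t. d (1 - t))"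
        by (rule pathin_compose[OF c(1) r] pathin_reverse[OF d(1)])+
      show "(r \<circ> c) 0 = d (1 - 0)"
        using c(2) Y(3) j by (simp add: r_def e0_def) (simp add: j_def)
      show "q ((r \<circ> c) t) = q (d (1 - t))" if "t \<in> {0..1}" for t
        using that d(3)[of "1 - t"] qr[of "c t"] path_image_subset_topspace[OF c(1)] by (auto simp: Pi_iff)
    qed
    then have "r y0 = z0"
      using c(3) d(2) by simp
    moreover have "Peano_covering_map Y Z r"
      by (rule Peano_covering_map_cancel_left[OF p q r qr])
    ultimately show ?thesis
      using qr by blast
  qed
  show thesis
  proof (rule that[of Y p])
    show "topspace Y \<noteq> {}"
      using Y(2) by blast
    show "universal_Peano_covering_map TYPE('x covering_point) Y X p"
      unfolding universal_Peano_covering_map_def using p lift by blast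
  qed
qed

text \<open>
  A map of \<open>Y\<close> into the copy of the path component of \<open>z0\<close> on the type of sets of paths becomes a map
  into \<open>Z\<close> by composition with the Peano covering map from that copy to \<open>Z\<close>.
\<close>

lemma universal_Peano_covering_map_any_type:
  fixes X :: "'x topology" and Y :: "'y topology"
  assumes Y: "universal_Peano_covering_map TYPE('x covering_point) Y X p"
  shows "universal_Peano_covering_map TYPE('z) Y X p"
  unfolding universal_Peano_covering_map_def
proof (intro conjI allI impI ballI)
  show "Peano_covering_map Y X p"
    using Y by (simp add: universal_Peano_covering_map_def)
  fix Z :: "'z topology" and q z0 y0
  assume q: "Peano_covering_map Z X q" and z0: "z0 \<in> topspace Z" and y0: "y0 \<in> topspace Y"
    and eq: "q z0 = p y0"
  from path_component_copy[OF q z0]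
  obtain Z' :: "'x covering_point topology" and i z0' where
    i: "Peano_covering_map Z' Z i" and "path_connected_space Z'"
    and z0': "z0' \<in> topspace Z'" "i z0' = z0" .
  have "Peano_covering_map Z' X (q \<circ> i)" "(q \<circ> i) z0' = p y0"
    using Peano_covering_map_compose[OF i q] z0'(2) eq by auto
  then obtain r where r: "Peano_covering_map Y Z' r"
    "\<forall>y\<in>topspace Y. (q \<circ> i) (r y) = p y" "r y0 = z0'"
    using Y z0'(1) y0 unfolding universal_Peano_covering_map_def by blast
  show "\<exists>r. Peano_covering_map Y Z r \<and> (\<forall>y\<in>topspace Y. q (r y) = p y) \<and> r y0 = z0"
    using Peano_covering_map_compose[OF r(1) i] r(2,3) z0'(2) by (intro exI[of _ "i \<circ> r"]) auto
qed

lemma universal_Peano_covering_map_normal_image: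
  fixes Y :: "'y topology"
  assumes Y: "universal_Peano_covering_map TYPE('y) Y X p" and y0: "y0 \<in> topspace Y"
  shows "fundamental_group_map X (p y0) p ` carrier (fundamental_group Y y0)
    \<lhd> fundamental_group X (p y0)"
proof (rule normal_image_if_transitive_deck_maps[OF _ y0])
  show p: "Peano_covering_map Y X p"
    using Y by (simp add: universal_Peano_covering_map_def)
  show "\<exists>r. continuous_map Y Y r \<and> (\<forall>y\<in>topspace Y. p (r y) = p y) \<and> r y0 = y1"
    if "y1 \<in> topspace Y" "p y1 = p y0" for y1
    using Y p y0 that Peano_covering_map_continuous
    unfolding universal_Peano_covering_map_def by meson
qed

theorem corollary7p10:
  fixes X :: "'x topology"
  assumes "path_connected_space X" and "topspace X \<noteq> {}"
  shows
    "(\<exists>(Y :: 'x covering_point topology) p.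
        topspace Y \<noteq> {} \<and>
        universal_Peano_covering_map TYPE('x covering_point) Y X p \<and>
        (\<forall>y0 \<in> topspace Y.
           fundamental_group_map X (p y0) p ` carrier (fundamental_group Y y0)
             \<lhd> fundamental_group X (p y0))) \<and>
     (\<forall>(Y :: 'x covering_point topology) p.
        universal_Peano_covering_map TYPE('x covering_point) Y X p \<longrightarrow>
        universal_Peano_covering_map TYPE('z) Y X p)"
proof (intro conjI allI impI)
  from exists_universal_Peano_covering_map[OF assms]
  obtain Y :: "'x covering_point topology" and p where
    Y: "topspace Y \<noteq> {}" "universal_Peano_covering_map TYPE('x covering_point) Y X p" .
  then show "\<exists>(Y :: 'x covering_point topology) p.
        topspace Y \<noteq> {} \<and>
        universal_Peano_covering_map TYPE('x covering_point) Y X p \<and>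
        (\<forall>y0 \<in> topspace Y.
           fundamental_group_map X (p y0) p ` carrier (fundamental_group Y y0)
             \<lhd> fundamental_group X (p y0))"
    using universal_Peano_covering_map_normal_image[OF Y(2)] by blast
qed (rule universal_Peano_covering_map_any_type)

end
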